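(* Let $F=\frac1M\sum_{m=1}^MF_m$, and suppose that each $F_m$ and $F$ itself are boundedly Lipschitz with constants $L$ and $D$, i.e. $\|G(z_1)-G(z_2)\|^2\le L^2\|z_1-z_2\|^2+D^2$ for all $z_1,z_2\in\mathcal Z$ and $G\in\{F,F_1,\dots,F_M\}$. Let $Q$ be a quantization with parameter $\omega$, and let the iterates be generated by the quantized extragradient method with variance reduction: $z^0=w^0\in\mathcal Z$ and, for $k=0,\dots,K-1$, $m_k$ uniform on $\{1,\dots,M\}$, $\bar z^k=\tau z^k+(1-\tau)w^k$, $$z^{k+1/2}=\mathrm{prox}_{\gamma h}(\bar z^k-\gamma F(w^k)),\quad z^{k+1}=\mathrm{prox}_{\gamma h}\big(\bar z^k-\gamma Q(F_{m_k}(z^{k+1/2})-F_{m_k}(w^k))-\gamma F(w^k)\big),$$ $w^{k+1}=z^{k+1}$ with probability $1-\tau$ and $w^{k+1}=w^k$ with probability $\tau$. Then: (i) in the strongly monotone case with $0<\gamma\le\min\left\{\frac{\sqrt{1-\tau}}{2L\sqrt{2\omega}};\frac{1-\tau}{4(\mu_F+\mu_h)}\right\}$, $$\mathbb{E}\big[\tau\|z^K-z^*\|^2+\|w^K-z^*\|^2\big]\le\left(1-\gamma\cdot\frac{\mu_F+\mu_h}{16}\right)^{K-1}\big(\tau\|z^0-z^*\|^2+\|w^0-z^*\|^2\big)+\frac{32\gamma\omega D^2}{\mu_F+\mu_h};$$ (ii) in the monotone case with $0<\gamma\le\frac{\sqrt{1-\tau}}{2L\sqrt{4\omega+2}}$,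 $$\mathbb{E}[\mathrm{Gap}(\hat z^K)]\le\frac{8\max_{u\in\mathcal C}\|z^0-u\|^2}{\gamma K}+\gamma(9\omega+2)D^2,\qquad\hat z^K=\frac1K\sum_{k=0}^{K-1}z^{k+1/2}.$$
   Context: A quantization with parameter $\omega$ is a random map $Q:\mathbb{R}^d\to\mathbb{R}^d$ with $\mathbb{E}Q(x)=x$ and $\mathbb{E}\|Q(x)\|^2=\omega\|x\|^2$ for all $x\in\mathbb{R}^d$. $h:\mathbb{R}^d\to\mathbb{R}\cup\{+\infty\}$ is proper, lower semicontinuous, convex; $F,F_m:\mathbb{R}^d\to\mathbb{R}^d$; $\mathcal Z\subseteq\mathbb{R}^d$ is nonempty, closed, convex, with $\mathrm{dom}\,h\subseteq\mathcal Z$; $\tau\in[0,1)$. $z^*\in\mathcal Z$ is a solution of the variational inequality $\langle F(z^* ),z-z^*\rangle+h(z)-h(z^* )\ge0$ for all $z\in\mathcal Z$. $\mathrm{prox}_{\gamma h}(z)=\arg\min_x\{\gamma h(x)+\frac12\|z-x\|^2\}$. Strongly monotone case: there are $\mu_F,\mu_h\ge0$ with $\mu_F+\mu_h>0$ such that for all $z_1,z_2\in\mathcal Z$: $\langle F(z_1)-F(z_2),z_1-z_2\rangle\ge\mu_F\|z_1-z_2\|^2$ and $h(z_1)-h(z_2)-\langle\nabla h(z_2),z_1-z_2\rangle\ge\frac{\mu_h}{2}\|z_1-z_2\|^2$ ($\nabla h$ denotes a subgradient). Monotone case: the same with $\mu_F=\mu_h=0$. $\mathrm{Gap}(z)=\max_{u\in\mathcal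 C}[\langle F(u),z-u\rangle+h(z)-h(u)]$, where $\mathcal C$ is a compact subset of $\mathcal Z$ containing $z^*$. $z^0$ is deterministic, $K\ge1$, and all random choices (including the randomness of each application of $Q$) are made independently of everything generated before them and of each other. *)

theory Defs
  imports "HOL-Probability.Probability"
begin

text \<open>
  Functions \<open>h\<close> with values in the reals extended by plus infinity are rendered as
  \<open>ereal\<close>-valued functions; the value minus infinity is excluded by \<open>proper_fun\<close>.
\<close>

definition proper_fun :: "('a \<Rightarrow> ereal) \<Rightarrow> bool" where
  "proper_fun h \<longleftrightarrow> (\<forall>x. h x \<noteq> -\<infinity>) \<and> (\<exists>x. h x \<noteq> \<infinity>)"

definition lsc_fun :: "('a::topological_space \<Rightarrow> ereal) \<Rightarrow> bool" where
  "lsc_fun h \<longleftrightarrow> (\<forall>x. h x \<le> Liminf (at x) h)"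

definition convex_fun :: "('a::real_vector \<Rightarrow> ereal) \<Rightarrow> bool" where
  "convex_fun h \<longleftrightarrow> (\<forall>x y. \<forall>t\<in>{0..1}.
     h ((1 - t) *\<^sub>R x + t *\<^sub>R y) \<le> ereal (1 - t) * h x + ereal t * h y)"

definition subdifferential :: "('a::real_inner \<Rightarrow> ereal) \<Rightarrow> 'a \<Rightarrow> 'a set" where
  "subdifferential h x =
     {g. \<bar>h x\<bar> \<noteq> \<infinity> \<and> (\<forall>y. h y \<ge> h x + ereal (g \<bullet> (y - x)))}"

definition prox :: "real \<Rightarrow> ('a::real_inner \<Rightarrow> ereal) \<Rightarrow> 'a \<Rightarrow> 'a" where
  "prox \<gamma> h z = arg_min (\<lambda>x. ereal \<gamma> * h x + ereal (1/2 * (norm (z - x))\<^sup>2)) (\<lambda>_. True)"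

text \<open>
  For proper \<open>h\<close> with effective domain inside \<open>Z\<close> the inequality forces \<open>h zs\<close> to be finite:
  a finite number minus infinity is minus infinity.
\<close>

definition vi_solution ::
  "'a::real_inner set \<Rightarrow> ('a \<Rightarrow> 'a) \<Rightarrow> ('a \<Rightarrow> ereal) \<Rightarrow> 'a \<Rightarrow> bool" where
  "vi_solution Z F h zs \<longleftrightarrow>
     zs \<in> Z \<and> (\<forall>z\<in>Z. ereal (F zs \<bullet> (z - zs)) + h z - h zs \<ge> 0)"

definition boundedly_lipschitz ::
  "'a::real_normed_vector set \<Rightarrow> real \<Rightarrow> real \<Rightarrow> ('a \<Rightarrow> 'a) \<Rightarrow> bool" where
  "boundedly_lipschitz Z L D G \<longleftrightarrow>
     (\<forall>z1\<in>Z. \<forall>z2\<in>Z. (norm (G z1 - G z2))\<^sup>2 \<le> L\<^sup>2 * (norm (z1 - z2))\<^sup>2 + D\<^sup>2)"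

text \<open>
  The inequality for \<open>h\<close> is required at every point of \<open>Z\<close> where a subgradient exists, and for
  each subgradient there. Both parameters equal to zero give the monotone case.
\<close>

definition monotone_pair ::
  "'a::real_inner set \<Rightarrow> ('a \<Rightarrow> 'a) \<Rightarrow> ('a \<Rightarrow> ereal) \<Rightarrow> real \<Rightarrow> real \<Rightarrow> bool" where
  "monotone_pair Z F h \<mu>F \<mu>h \<longleftrightarrow>
     (\<forall>z1\<in>Z. \<forall>z2\<in>Z. (F z1 - F z2) \<bullet> (z1 - z2) \<ge> \<mu>F * (norm (z1 - z2))\<^sup>2) \<and>
     (\<forall>z1\<in>Z. \<forall>z2\<in>Z. \<forall>g\<in>subdifferential h z2.
        h z1 - h z2 - ereal (g \<bullet> (z1 - z2)) \<ge> ereal (\<mu>h / 2 * (norm (z1 - z2))\<^sup>2))"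

text \<open>
  A random map is a jointly measurable \<open>Q \<xi> x\<close> whose randomness \<open>\<xi>\<close> is drawn from the
  probability space \<open>N\<close>; independent applications of the map use independent draws of \<open>\<xi>\<close>.
\<close>

definition quantization ::
  "'q measure \<Rightarrow> ('q \<Rightarrow> 'a::euclidean_space \<Rightarrow> 'a) \<Rightarrow> real \<Rightarrow> bool" where
  "quantization N Q \<omega> \<longleftrightarrow>
     prob_space N \<and>
     (\<lambda>(\<xi>, x). Q \<xi> x) \<in> borel_measurable (N \<Otimes>\<^sub>M borel) \<and>
     (\<forall>x. has_bochner_integral N (\<lambda>\<xi>. Q \<xi> x) x \<and>
          has_bochner_integral N (\<lambda>\<xi>. (norm (Q \<xi> x))\<^sup>2) (\<omega> * (norm x)\<^sup>2))"

text \<open>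
  Joint law of the random choices of one iteration: the index, the randomness of the quantization
  and the coin that decides (on \<open>True\<close>) to update the reference point. The product measure
  expresses that the three are independent of each other.
\<close>

definition draw_law :: "nat \<Rightarrow> 'q measure \<Rightarrow> real \<Rightarrow> (nat \<times> 'q \<times> bool) measure" where
  "draw_law M N \<tau> = uniform_count_measure {1..M} \<Otimes>\<^sub>M
     (N \<Otimes>\<^sub>M measure_pmf (bernoulli_pmf (1 - \<tau>)))"

text \<open>
  The operator \<open>F\<close> need not be continuous, so the maximum over \<open>C\<close> is a supremum. Points
  \<open>u\<close> with infinite \<open>h u\<close> contribute minus infinity whenever \<open>h z\<close> is finite.
\<close>

definition gap ::
  "'a::real_inner set \<Rightarrow> ('a \<Rightarrow> 'a) \<Rightarrow> ('a \<Rightarrow> ereal) \<Rightarrow> 'a \<Rightarrow> ereal" where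
  "gap C F h z = (SUP u\<in>C. ereal (F u \<bullet> (z - u)) + h z - h u)"

end

(*
  Adding the two prox inequalities of an iteration and expanding squares bounds the potential
  \<tau> |z - u|^2 + |w - u|^2 at the next iterate by its present value plus conditionally centred terms
  (the quantization error and the centred coin) and gamma^2 |q|^2. For u = z* the centred terms vanish
  in expectation and strong monotonicity yields a contraction. For the gap, u ranges over C before the
  expectation is taken, so the centred terms that depend on u are collected into a martingale S:
  <S, u - z0> <= 14 |u - z0|^2 + |S|^2 / 56, and the increments of E |S|^2 are absorbed by the negative
  terms -(1 - \<tau>) |w - y|^2 and -|y - z|^2 / 2, where y is the half step.
*)
theory Submission
  imports Defs
begin

section \<open>The proximal operator\<close>

text \<open>In the gap the maximizing u depends on the sample, so terms centred for fixed u need not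
  average out. The split works because they are affine in u: in b (|z' - u|^2 - |w - u|^2), with b
  the centred coin and z' the next iterate, the squares of u cancel. The constants come from the
  target bound. The initial potential costs at most 2 |u - z0|^2, and 16 |u - z0|^2 divided by 2
  \<gamma> K is the stated leading term; this leaves 14 for Young's inequality and hence 1/56 in
  front of |S|^2. Three foundational points need care. The proximal map is a choice of minimizer, so
  existence must be proved. The operators may jump, so measurability is tracked on Z only, and the
  gap, a supremum over a possibly uncountable set, is measurable because lower semicontinuity of h
  makes its sublevel sets closed relative to the domain of h. Conditional means are computed by
  Fubini: the joint law of the past and the next draw is a product.\<close>

lemma open_lt_lsc_fun:
  fixes h :: "'a::perfect_space \<Rightarrow> ereal" and g :: "'a \<Rightarrow> real"
  assumes "lsc_fun h" and g: "continuous_on UNIV g"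
  shows "open {x. ereal (g x) < h x}"
proof (subst open_subopen, safe)
  fix x assume "ereal (g x) < h x"
  then obtain r where r: "g x < r" "ereal r < h x"
    using ereal_dense2 by (metis ereal_less(2) less_ereal.simps(1))
  \<comment> \<open>\<open>at x\<close> ignores the point \<open>x\<close> itself; there the bound
    \<open>r < h x\<close> from the choice of \<open>r\<close> is used.\<close>
  have "ereal r < Liminf (at x) h"
    using assms(1) r(2) unfolding lsc_fun_def by (meson less_le_trans)
  then have "\<forall>\<^sub>F y in at x. ereal r < h y" by (rule less_LiminfD)
  then obtain S where S: "open S" "x \<in> S" "\<forall>y\<in>S. y \<noteq> x \<longrightarrow> ereal r < h y"
    unfolding eventually_at_topological by auto
  have "open {y. g y < r}" using g by (intro open_Collect_less) auto
  then have "open (S \<inter> {y. g y < r})" using S by auto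
  moreover have "S \<inter> {y. g y < r} \<subseteq> {y. ereal (g y) < h y}"
  proof safe
    fix y assume y: "y \<in> S" "g y < r"
    then have "ereal r < h y" using S r by (cases "y = x") auto
    with y show "ereal (g y) < h y" by (meson ereal_less_eq(3) le_less_trans less_imp_le)
  qed
  ultimately show "\<exists>T. open T \<and> x \<in> T \<and> T \<subseteq> {x. ereal (g x) < h x}"
    using S r by (intro exI[of _ "S \<inter> {y. g y < r}"]) auto
qed

text \<open>If no point were minimal, the open sets \<open>r < f x\<close>, with \<open>r\<close>
  above some value of \<open>f\<close> on \<open>S\<close>, would cover \<open>S\<close>. The
  smallest level of a finite subcover still bounds some value \<open>f y\<close>, yet
  \<open>y\<close> lies in a member whose level is below \<open>f y\<close>.\<close>

lemma lsc_attains_inf: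
  fixes f :: "'a::topological_space \<Rightarrow> ereal"
  assumes S: "compact S" "x0 \<in> S" and x0: "f x0 < \<infinity>"
    and lsc: "\<And>r::real. open {x. ereal r < f x}"
  shows "\<exists>x\<in>S. \<forall>y\<in>S. f x \<le> f y"
proof (rule ccontr)
  assume "\<not> ?thesis"
  then have no: "\<forall>x\<in>S. \<exists>y\<in>S. f y < f x" by (auto simp: not_le)
  define I where "I = {r. \<exists>y\<in>S. f y \<le> ereal r}"
  have cov: "S \<subseteq> (\<Union>r\<in>I. {x. ereal r < f x})"
  proof
    fix x assume "x \<in> S"
    then obtain y where y: "y \<in> S" "f y < f x" using no by auto
    then obtain r where "f y < ereal r" "ereal r < f x" using ereal_dense2 by blast
    with y show "x \<in> (\<Union>r\<in>I. {x. ereal r < f x})" unfolding I_def by (auto intro: less_imp_le)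
  qed
  obtain T where T: "T \<subseteq> I" "finite T" "S \<subseteq> (\<Union>r\<in>T. {x. ereal r < f x})"
    using compactE_image[OF S(1) _ cov] lsc by blast
  have "T \<noteq> {}" using T S by auto
  then have "Min T \<in> I" using T(1,2) Min_in by blast
  then obtain y where y: "y \<in> S" "f y \<le> ereal (Min T)" unfolding I_def by auto
  then obtain r where r: "r \<in> T" "ereal r < f y" using T by auto
  then have "ereal (Min T) \<le> ereal r" using T by auto
  with y r show False by (meson le_less_trans not_less order.trans)
qed

lemma convex_fun_real:
  assumes "convex_fun h" "h x = ereal a" "h y = ereal b" "0 \<le> t" "t \<le> 1"
  shows "h ((1 - t) *\<^sub>R x + t *\<^sub>R y) \<le> ereal ((1 - t) * a + t * b)"
  using assms unfolding convex_fun_def by (metis atLeastAtMost_iff plus_ereal.simps(1) times_ereal.simps(1))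

text \<open>This gives coercivity of the proximal objective without separating hyperplanes:
  \<open>h\<close> has a minimum \<open>m\<close> on the closed unit ball around \<open>x0\<close>,
  and since the unit sphere stays above \<open>m\<close>, convexity prevents \<open>h\<close> from
  falling faster than \<open>c = r0 - m\<close> per unit length along a ray.\<close>

lemma convex_lsc_minorant:
  fixes h :: "'a::euclidean_space \<Rightarrow> ereal"
  assumes h: "proper_fun h" "lsc_fun h" "convex_fun h" and x0: "h x0 = ereal r0"
  shows "\<exists>c\<ge>0. \<forall>y. ereal (r0 - c - c * norm (y - x0)) \<le> h y"
proof -
  have "\<exists>x\<in>cball x0 1. \<forall>y\<in>cball x0 1. h x \<le> h y"
    using open_lt_lsc_fun[OF h(2)] x0 by (intro lsc_attains_inf[of _ x0]) auto
  then obtain xm where xm: "\<forall>y\<in>cball x0 1. h xm \<le> h y" by auto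
  then have "h xm \<le> ereal r0" using x0 by (metis centre_in_cball zero_le_one)
  moreover have "h xm \<noteq> -\<infinity>" using h(1) by (auto simp: proper_fun_def)
  ultimately obtain m where m: "h xm = ereal m" "m \<le> r0" by (cases "h xm") auto
  define c where "c = r0 - m"
  have "ereal (r0 - c - c * norm (y - x0)) \<le> h y" for y
  proof (cases "norm (y - x0) \<le> 1")
    case True
    then have "h xm \<le> h y" using xm by (auto simp: dist_norm norm_minus_commute)
    moreover have "r0 - c - c * norm (y - x0) \<le> m" unfolding c_def using m by auto
    ultimately show ?thesis using m(1) by (metis ereal_less_eq(3) order.trans)
  next
    case False
    show ?thesis
    proof (cases "h y")
      case (real b)
      \<comment> \<open>Puts the convex combination with weight \<open>t\<close> on the unit sphere
        around \<open>x0\<close>.\<close>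
      define t where "t = 1 / norm (y - x0)"
      have t: "0 < t" "t \<le> 1" "t * norm (y - x0) = 1" using False by (auto simp: t_def divide_le_eq_1)
      have "((1 - t) *\<^sub>R x0 + t *\<^sub>R y) - x0 = t *\<^sub>R (y - x0)" by (simp add: algebra_simps)
      then have "(1 - t) *\<^sub>R x0 + t *\<^sub>R y \<in> cball x0 1"
        using t by (simp add: dist_norm norm_minus_commute[of x0])
      then have "ereal m \<le> ereal ((1 - t) * r0 + t * b)"
        using xm m convex_fun_real[OF h(3) x0 real, of t] t by (metis order.trans less_imp_le)
      then have "t * (r0 - b) \<le> c" unfolding c_def by (simp add: algebra_simps)
      then have "(t * norm (y - x0)) * (r0 - b) \<le> c * norm (y - x0)"
        using mult_right_mono[of _ _ "norm (y - x0)"] by (metis mult.assoc mult.commute norm_ge_zero)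
      then show ?thesis using t real m by (simp add: c_def)
    qed (use h in \<open>auto simp: proper_fun_def\<close>)
  qed
  with m show ?thesis unfolding c_def by (intro exI[of _ "r0 - m"]) auto
qed

text \<open>\<open>prox\<close> picks a minimizer by choice, so a minimizer must be exhibited: lower
  semicontinuity provides one over a ball, and outside that ball the quadratic term beats the linear
  minorant of \<open>h\<close>, which keeps the objective above its value at
  \<open>x0\<close>.\<close>

lemma prox_is_arg_min:
  fixes h :: "'a::euclidean_space \<Rightarrow> ereal"
  assumes h: "proper_fun h" "lsc_fun h" "convex_fun h" and \<gamma>: "0 < \<gamma>"
  shows "ereal \<gamma> * h (prox \<gamma> h z) + ereal (1/2 * (norm (z - prox \<gamma> h z))\<^sup>2)
    \<le> ereal \<gamma> * h y + ereal (1/2 * (norm (z - y))\<^sup>2)"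
proof -
  define f where "f = (\<lambda>x. ereal \<gamma> * h x + ereal (1/2 * (norm (z - x))\<^sup>2))"
  obtain x0 r0 where x0: "h x0 = ereal r0" using h(1) unfolding proper_fun_def
    by (metis ereal_cases)
  obtain c where c: "c \<ge> 0" "\<And>y. ereal (r0 - c - c * norm (y - x0)) \<le> h y"
    using convex_lsc_minorant[OF h x0] by auto
  define d where "d = norm (z - x0)"
  \<comment> \<open>For \<open>t > R\<close> the factor \<open>t / 2 - (d + \<gamma> * c)\<close> is
    at least 1, so its product with \<open>t\<close> is at least \<open>t\<close>, and
    \<open>t\<close> exceeds \<open>\<gamma> * c\<close>. This is fact 2 below.\<close>
  define R where "R = 2 * (d + \<gamma> * c) + 2"
  have R: "R > 0" unfolding R_def d_def using c \<gamma> by (simp add: add_nonneg_pos)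
  \<comment> \<open>Moving the quadratic to the other side brings the superlevel sets of
    \<open>f\<close> into the form of \<open>open_lt_lsc_fun\<close>.\<close>
  have iff: "(ereal r < f x) = (ereal ((r - 1/2 * (norm (z - x))\<^sup>2) / \<gamma>) < h x)" for r x
    unfolding f_def using h(1) \<gamma> by (cases "h x") (auto simp: proper_fun_def field_simps)
  have "open {x. ereal r < f x}" for r
    unfolding iff by (intro open_lt_lsc_fun[OF h(2)] continuous_intros) (use \<gamma> in auto)
  then have "\<exists>x\<in>cball x0 R. \<forall>y\<in>cball x0 R. f x \<le> f y"
    using R x0 by (intro lsc_attains_inf[of _ x0]) (auto simp: f_def)
  then obtain p where p: "\<And>y. y \<in> cball x0 R \<Longrightarrow> f p \<le> f y" by blast
  have "f p \<le> f y" for y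
  proof (cases "y \<in> cball x0 R")
    case False
    define t where "t = norm (y - x0)"
    have t: "t > R" using False by (simp add: t_def dist_norm norm_minus_commute)
    have "t - d \<le> norm (z - y)" unfolding t_def d_def
      using norm_triangle_ineq[of "y - z" "z - x0"] by (simp add: norm_minus_commute)
    moreover have "t - d \<ge> 0" using t c \<gamma> unfolding R_def d_def
      by (smt (verit, ccfv_SIG) mult_nonneg_nonneg norm_ge_zero)
    ultimately have 1: "(t - d)\<^sup>2 \<le> (norm (z - y))\<^sup>2" by (rule power_mono)
    have "t * 1 \<le> t * (t / 2 - (d + \<gamma> * c))"
      using t R by (intro mult_left_mono) (auto simp: R_def)
    then have 2: "\<gamma> * c + t * (d + \<gamma> * c) \<le> t\<^sup>2 / 2"
      using t c \<gamma> unfolding R_def d_def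
      by (smt (verit, ccfv_SIG) mult_nonneg_nonneg norm_ge_zero power2_eq_square right_diff_distrib' times_divide_eq_right mult_1_right)
    have 3: "\<gamma> * r0 + 1/2 * d\<^sup>2 \<le> \<gamma> * (r0 - c - c * t) + 1/2 * (norm (z - y))\<^sup>2"
      using 1 2 by (simp add: power2_diff algebra_simps)
    have "f p \<le> f x0" using p R by auto
    also have "f x0 = ereal (\<gamma> * r0 + 1/2 * d\<^sup>2)" by (simp add: f_def x0 d_def)
    also have "\<dots> \<le> f y"
    proof (cases "h y")
      case (real b)
      have "\<gamma> * (r0 - c - c * t) \<le> \<gamma> * b"
        using c(2)[of y] real \<gamma> by (simp add: t_def)
      with 3 show ?thesis by (simp add: f_def real)
    qed (use h \<gamma> in \<open>auto simp: proper_fun_def f_def\<close>)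
    finally show ?thesis .
  qed (use p in auto)
  then have "is_arg_min f (\<lambda>_. True) p" by (auto simp: is_arg_min_def not_less)
  then have "is_arg_min f (\<lambda>_. True) (prox \<gamma> h z)"
    unfolding prox_def f_def[symmetric] arg_min_def by (rule someI)
  then show ?thesis by (auto simp: is_arg_min_def not_less f_def)
qed

lemma prox_finite:
  fixes h :: "'a::euclidean_space \<Rightarrow> ereal"
  assumes h: "proper_fun h" "lsc_fun h" "convex_fun h" and \<gamma>: "0 < \<gamma>"
  shows "\<bar>h (prox \<gamma> h z)\<bar> \<noteq> \<infinity>"
proof -
  obtain x0 r0 where x0: "h x0 = ereal r0" using h(1) unfolding proper_fun_def
    by (metis ereal_cases)
  show ?thesis using prox_is_arg_min[OF assms, of z x0] h(1) x0 \<gamma>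
    by (cases "h (prox \<gamma> h z)") (auto simp: proper_fun_def)
qed

section \<open>Subgradient inequality and nonexpansiveness of the proximal map\<close>

lemma norm_diff_scaleR_sq:
  fixes d e :: "'a::real_inner"
  shows "(norm (d - t *\<^sub>R e))\<^sup>2 = (norm d)\<^sup>2 - 2 * t * (d \<bullet> e) + t\<^sup>2 * (norm e)\<^sup>2"
  unfolding power2_norm_eq_inner
  by (simp add: inner_diff_left inner_diff_right inner_commute power2_eq_square algebra_simps)

text \<open>First-order optimality without differentiating \<open>h\<close>: compare
  \<open>p\<close> with the point at parameter \<open>t\<close> on the segment towards
  \<open>y\<close>, divide by \<open>t\<close>, and let \<open>t\<close> tend to 0 from the right,
  where the quadratic remainder vanishes.\<close>

lemma prox_subgradient:
  fixes h :: "'a::euclidean_space \<Rightarrow> ereal"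
  assumes h: "proper_fun h" "lsc_fun h" "convex_fun h" and \<gamma>: "0 < \<gamma>"
  shows "(1 / \<gamma>) *\<^sub>R (z - prox \<gamma> h z) \<in> subdifferential h (prox \<gamma> h z)"
proof -
  define p where "p = prox \<gamma> h z"
  obtain a where a: "h p = ereal a" using prox_finite[OF assms, of z] by (auto simp: p_def)
  have "h y \<ge> h p + ereal (((1 / \<gamma>) *\<^sub>R (z - p)) \<bullet> (y - p))" for y
  proof (cases "h y")
    case (real b)
    have key: "\<gamma> * (a - b) + (z - p) \<bullet> (y - p) \<le> t * (1/2 * (norm (y - p))\<^sup>2)" if t: "0 < t" "t \<le> 1" for t
    proof -
      define v where "v = (1 - t) *\<^sub>R p + t *\<^sub>R y"
      have "h v \<le> ereal ((1 - t) * a + t * b)"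
        unfolding v_def using convex_fun_real[OF h(3) a real] t by auto
      then have "ereal \<gamma> * h v \<le> ereal (\<gamma> * ((1 - t) * a + t * b))"
        using \<gamma> by (cases "h v") auto
      moreover have "ereal (\<gamma> * a + 1/2 * (norm (z - p))\<^sup>2) \<le> ereal \<gamma> * h v + ereal (1/2 * (norm (z - v))\<^sup>2)"
        using prox_is_arg_min[OF assms, of z v] a by (simp add: p_def)
      ultimately have "ereal (\<gamma> * a + 1/2 * (norm (z - p))\<^sup>2)
          \<le> ereal (\<gamma> * ((1 - t) * a + t * b)) + ereal (1/2 * (norm (z - v))\<^sup>2)"
        by (meson add_right_mono order.trans)
      then have 1: "\<gamma> * a + 1/2 * (norm (z - p))\<^sup>2 \<le> \<gamma> * ((1 - t) * a + t * b) + 1/2 * (norm (z - v))\<^sup>2"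
        by simp
      have "z - v = (z - p) - t *\<^sub>R (y - p)" by (simp add: v_def algebra_simps)
      then have "(norm (z - v))\<^sup>2 = (norm (z - p))\<^sup>2 - 2 * t * ((z - p) \<bullet> (y - p)) + t\<^sup>2 * (norm (y - p))\<^sup>2"
        by (simp only: norm_diff_scaleR_sq)
      with 1 have "t * (\<gamma> * (a - b) + (z - p) \<bullet> (y - p)) \<le> t * (t * (1/2 * (norm (y - p))\<^sup>2))"
        by (simp add: algebra_simps power2_eq_square)
      with t show ?thesis by simp
    qed
    have "((\<lambda>t. t * (1/2 * (norm (y - p))\<^sup>2)) \<longlongrightarrow> 0 * (1/2 * (norm (y - p))\<^sup>2)) (at_right 0)"
      by (intro tendsto_intros)
    moreover have "\<forall>\<^sub>F t in at_right 0. \<gamma> * (a - b) + (z - p) \<bullet> (y - p) \<le> t * (1/2 * (norm (y - p))\<^sup>2)"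
      using eventually_at_right_less[of 0] eventually_at_right_real[OF zero_less_one]
      by eventually_elim (use key in auto)
    ultimately have "\<gamma> * (a - b) + (z - p) \<bullet> (y - p) \<le> 0"
      using tendsto_lowerbound[of _ 0 "at_right (0::real)"] by fastforce
    then have "(z - p) \<bullet> (y - p) \<le> (b - a) * \<gamma>" by (simp add: algebra_simps)
    then have "((z - p) \<bullet> (y - p)) / \<gamma> \<le> b - a" using \<gamma> by (simp only: pos_divide_le_eq)
    then show ?thesis by (simp add: a real)
  qed (use h a in \<open>auto simp: proper_fun_def\<close>)
  then show ?thesis using a by (auto simp: subdifferential_def p_def)
qed

text \<open>The subgradient inequalities at the two proximal points, each tested at the other, add
  up to an inequality free of \<open>h\<close>, namely firm nonexpansiveness. The result serves
  twice: for measurability of the iterates through continuity, and for their second moments.\<close>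

lemma prox_nonexpansive:
  fixes h :: "'a::euclidean_space \<Rightarrow> ereal"
  assumes h: "proper_fun h" "lsc_fun h" "convex_fun h" and \<gamma>: "0 < \<gamma>"
  shows "norm (prox \<gamma> h x - prox \<gamma> h y) \<le> norm (x - y)"
proof -
  define p q where "p = prox \<gamma> h x" and "q = prox \<gamma> h y"
  obtain a b where ab: "h p = ereal a" "h q = ereal b"
    using prox_finite[OF assms, of x] prox_finite[OF assms, of y] by (auto simp: p_def q_def)
  have "h p + ereal (((1 / \<gamma>) *\<^sub>R (x - p)) \<bullet> (q - p)) \<le> h q"
    "h q + ereal (((1 / \<gamma>) *\<^sub>R (y - q)) \<bullet> (p - q)) \<le> h p"
    using prox_subgradient[OF assms, of x] prox_subgradient[OF assms, of y]
    unfolding subdifferential_def p_def[symmetric] q_def[symmetric] by blast+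
  then have "a + ((1 / \<gamma>) *\<^sub>R (x - p)) \<bullet> (q - p) \<le> b" "b + ((1 / \<gamma>) *\<^sub>R (y - q)) \<bullet> (p - q) \<le> a"
    by (simp_all add: ab)
  then have "(1 / \<gamma>) * ((x - p) \<bullet> (q - p) + (y - q) \<bullet> (p - q)) \<le> 0" by (simp add: algebra_simps)
  then have "(x - p) \<bullet> (q - p) + (y - q) \<bullet> (p - q) \<le> 0" using \<gamma> by (simp add: divide_le_0_iff)
  then have "(norm (p - q))\<^sup>2 \<le> (x - y) \<bullet> (p - q)"
    unfolding power2_norm_eq_inner by (simp add: inner_diff_left inner_diff_right inner_commute)
  also have "\<dots> \<le> norm (x - y) * norm (p - q)" by (rule norm_cauchy_schwarz)
  finally show ?thesis unfolding p_def[symmetric] q_def[symmetric]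
    by (cases "norm (p - q) = 0") (auto simp: power2_eq_square)
qed

section \<open>Independent draws\<close>

definition sq_integrable :: "'s measure \<Rightarrow> ('s \<Rightarrow> 'a::euclidean_space) \<Rightarrow> bool" where
  "sq_integrable M f \<longleftrightarrow> f \<in> borel_measurable M \<and> integrable M (\<lambda>s. (norm (f s))\<^sup>2)"

lemma sq_integrable_bound:
  assumes "f \<in> borel_measurable M" "integrable M g" "\<And>s. s \<in> space M \<Longrightarrow> (norm (f s))\<^sup>2 \<le> g s"
  shows "sq_integrable M f"
  unfolding sq_integrable_def
proof
  show "integrable M (\<lambda>s. (norm (f s))\<^sup>2)"
    by (rule Bochner_Integration.integrable_bound[OF assms(2)])
      (use assms in \<open>auto intro!: AE_I2 intro: order.trans[OF _ abs_ge_self]\<close>)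
qed fact

lemma norm_add_sq_le:
  fixes x y :: "'a::real_inner"
  shows "(norm (x + y))\<^sup>2 \<le> 2 * (norm x)\<^sup>2 + 2 * (norm y)\<^sup>2"
proof -
  have "0 \<le> (norm (x - y))\<^sup>2" by simp
  then show ?thesis unfolding power2_norm_eq_inner by (simp add: inner_simps inner_commute)
qed

lemma sq_integrable_add:
  assumes "sq_integrable M f" "sq_integrable M g"
  shows "sq_integrable M (\<lambda>s. f s + g s)"
  using assms norm_add_sq_le
  by (intro sq_integrable_bound[where g="\<lambda>s. 2 * (norm (f s))\<^sup>2 + 2 * (norm (g s))\<^sup>2"])
    (auto simp: sq_integrable_def)

lemma sq_integrable_scaleR:
  assumes "sq_integrable M f"
  shows "sq_integrable M (\<lambda>s. c *\<^sub>R f s)"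
  using assms by (auto simp: sq_integrable_def power_mult_distrib)

lemma sq_integrable_diff:
  assumes "sq_integrable M f" "sq_integrable M g"
  shows "sq_integrable M (\<lambda>s. f s - g s)"
  using sq_integrable_add[OF assms(1) sq_integrable_scaleR[OF assms(2), of "-1"]] by simp

lemma (in finite_measure) sq_integrable_const: "sq_integrable M (\<lambda>_. c)"
  by (simp add: sq_integrable_def)

lemma sq_integrable_inner:
  assumes "sq_integrable M f" "sq_integrable M g"
  shows "integrable M (\<lambda>s. f s \<bullet> g s)"
proof (rule Bochner_Integration.integrable_bound)
  show "integrable M (\<lambda>s. (norm (f s))\<^sup>2 + (norm (g s))\<^sup>2)"
    using assms by (auto simp: sq_integrable_def)
  have "\<bar>x \<bullet> y\<bar> \<le> (norm x)\<^sup>2 + (norm y)\<^sup>2" for x y :: 'b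
  proof -
    have "\<bar>x \<bullet> y\<bar> \<le> norm x * norm y" by (rule Cauchy_Schwarz_ineq2)
    moreover have "2 * (norm x * norm y) \<le> (norm x)\<^sup>2 + (norm y)\<^sup>2"
      using sum_squares_bound[of "norm x" "norm y"] by simp
    moreover have "0 \<le> norm x * norm y" by simp
    ultimately show ?thesis by linarith
  qed
  then show "AE s in M. norm (f s \<bullet> g s) \<le> norm ((norm (f s))\<^sup>2 + (norm (g s))\<^sup>2)" by simp
qed (use assms in \<open>auto simp: sq_integrable_def\<close>)

lemma sq_integrable_cong:
  assumes "\<And>s. s \<in> space M \<Longrightarrow> f s = g s"
  shows "sq_integrable M f \<longleftrightarrow> sq_integrable M g"
  unfolding sq_integrable_def
  using assms by (intro conj_cong measurable_cong Bochner_Integration.integrable_cong) auto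

section \<open>The filtration generated by the draws, and independence of the next draw\<close>

definition history :: "'w measure \<Rightarrow> 'd measure \<Rightarrow> (nat \<Rightarrow> 'w \<Rightarrow> 'd) \<Rightarrow> nat \<Rightarrow> 'w measure" where
  "history P D X k = vimage_algebra (space P) (\<lambda>s. \<lambda>i\<in>{..<k}. X i s) (Pi\<^sub>M {..<k} (\<lambda>_. D))"

lemma space_history [simp]: "space (history P D X k) = space P"
  by (simp add: history_def)

lemma restrict_history_space:
  assumes "\<And>i. i < k \<Longrightarrow> X i \<in> space P \<rightarrow> space D"
  shows "(\<lambda>s. \<lambda>i\<in>{..<k}. X i s) \<in> space P \<rightarrow> space (Pi\<^sub>M {..<k} (\<lambda>_. D))"
  using assms by (auto simp: space_PiM restrict_PiE_iff Pi_iff)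

lemma measurable_history_self:
  assumes "i < k" "\<And>i. i < k \<Longrightarrow> X i \<in> space P \<rightarrow> space D"
  shows "X i \<in> measurable (history P D X k) D"
proof -
  have "(\<lambda>s. \<lambda>i\<in>{..<k}. X i s) \<in> measurable (history P D X k) (Pi\<^sub>M {..<k} (\<lambda>_. D))"
    unfolding history_def by (rule measurable_vimage_algebra1[OF restrict_history_space]) (use assms in auto)
  then have "(\<lambda>s. (\<lambda>i\<in>{..<k}. X i s) i) \<in> measurable (history P D X k) D"
    by (rule measurable_compose) (use assms in auto)
  then show ?thesis using assms by simp
qed

lemma measurable_history_mono:
  assumes f: "f \<in> measurable (history P D X k) N" and "k \<le> l"
    and X: "\<And>i. i < l \<Longrightarrow> X i \<in> space P \<rightarrow> space D"
  shows "f \<in> measurable (history P D X l) N"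
proof -
  have "(\<lambda>s. s) \<in> measurable (history P D X l) (history P D X k)"
    unfolding history_def[of P D X k]
  proof (rule measurable_vimage_algebra2)
    show "(\<lambda>s. \<lambda>i\<in>{..<k}. X i s) \<in> measurable (history P D X l) (Pi\<^sub>M {..<k} (\<lambda>_. D))"
      using assms by (intro measurable_restrict measurable_history_self) auto
  qed auto
  from measurable_compose[OF this f] show ?thesis .
qed

context prob_space
begin

lemma measurable_history_imp_measurable:
  assumes f: "f \<in> measurable (history M D X k) N" and X: "\<And>i. i < k \<Longrightarrow> X i \<in> measurable M D"
  shows "f \<in> measurable M N"
proof -
  have "(\<lambda>s. s) \<in> measurable M (history M D X k)"
    unfolding history_def[of M D X k]
    by (rule measurable_vimage_algebra2) (use X in \<open>auto intro!: measurable_restrict\<close>)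
  from measurable_compose[OF this f] show ?thesis .
qed

text \<open>The past is represented by the sample point itself, seen through the coarser
  sigma-algebra of the first \<open>k\<close> draws. Independence then becomes a product law for the
  pair of sample point and next draw, and any \<open>G (s, X k s)\<close> that is jointly measurable
  for that sigma-algebra can be integrated with the past frozen.\<close>

lemma distr_history:
  assumes ind: "indep_vars (\<lambda>_. D) X {..<K}" and k: "k < K"
  shows "(\<lambda>s. s) \<in> measurable M (history M D X k)" (is "?I \<in> _")
    and "distr M (history M D X k \<Otimes>\<^sub>M D) (\<lambda>s. (s, X k s)) = distr M (history M D X k) (\<lambda>s. s) \<Otimes>\<^sub>M distr M D (X k)"
proof -
  let ?H = "\<lambda>s. \<lambda>i\<in>{..<k}. X i s" and ?F = "history M D X k"
  have rv: "random_variable D (X i)" if "i < K" for i using ind that by (auto simp: indep_vars_def)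
  note [measurable] = rv[OF k]
  have Hsp: "?H \<in> space M \<rightarrow> space (Pi\<^sub>M {..<k} (\<lambda>_. D))"
    by (rule restrict_history_space, rule Pi_I, rule measurable_space[OF rv]) (use k in auto)
  show id[measurable]: "?I \<in> measurable M ?F"
    unfolding history_def by (rule measurable_vimage_algebra2)
      (use rv k in \<open>auto intro!: measurable_restrict\<close>)
  have ind2: "indep_var (Pi\<^sub>M {..<k} (\<lambda>_. D)) ?H (Pi\<^sub>M {k} (\<lambda>_. D)) (\<lambda>s. \<lambda>i\<in>{k}. X i s)"
    using k by (intro indep_var_restrict[OF ind]) auto
  interpret F: prob_space "distr M ?F ?I" by (rule prob_space_distr) (rule id)
  interpret D: prob_space "distr M D (X k)" by (rule prob_space_distr) (rule rv[OF k])
  have "distr M ?F ?I \<Otimes>\<^sub>M distr M D (X k) = distr M (?F \<Otimes>\<^sub>M D) (\<lambda>s. (s, X k s))"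
  proof (rule pair_measure_eqI)
    \<comment> \<open>Events of the history are preimages under the block of earlier draws, so on
      rectangles the claim is independence of the blocks \<open>{..<k}\<close> and
      \<open>{k}\<close>.\<close>
    fix A B assume AB: "A \<in> sets (distr M ?F ?I)" "B \<in> sets (distr M D (X k))"
    then obtain A' where A': "A' \<in> sets (Pi\<^sub>M {..<k} (\<lambda>_. D))" "A = ?H -` A' \<inter> space M"
      unfolding history_def sets_distr sets_vimage_algebra2[OF Hsp] by blast
    define B' where "B' = (\<lambda>f. f k) -` B \<inter> space (Pi\<^sub>M {k} (\<lambda>_. D))"
    have B': "B' \<in> sets (Pi\<^sub>M {k} (\<lambda>_. D))" unfolding B'_def using AB by auto
    have B'_eq: "(\<lambda>s. \<lambda>i\<in>{k}. X i s) -` B' \<inter> space M = X k -` B \<inter> space M"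
      using measurable_space[OF rv[OF k]] by (auto simp: B'_def space_PiM)
    have "prob ((\<lambda>s. (?H s, \<lambda>i\<in>{k}. X i s)) -` (A' \<times> B') \<inter> space M)
        = prob (?H -` A' \<inter> space M) * prob ((\<lambda>s. \<lambda>i\<in>{k}. X i s) -` B' \<inter> space M)"
      by (rule indep_varD[OF ind2 A'(1) B'])
    also have "(\<lambda>s. (?H s, \<lambda>i\<in>{k}. X i s)) -` (A' \<times> B') \<inter> space M = A \<inter> (X k -` B \<inter> space M)"
      unfolding A' B'_eq[symmetric] by auto
    finally have "prob (A \<inter> (X k -` B \<inter> space M)) = prob A * prob (X k -` B \<inter> space M)"
      unfolding B'_eq A'(2) .
    moreover have "A \<subseteq> space M" using A' by auto
    moreover have "(\<lambda>s. (s, X k s)) -` (A \<times> B) \<inter> space M = A \<inter> (X k -` B \<inter> space M)"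
      using \<open>A \<subseteq> space M\<close> by auto
    ultimately show "emeasure (distr M ?F ?I) A * emeasure (distr M D (X k)) B
        = emeasure (distr M (?F \<Otimes>\<^sub>M D) (\<lambda>s. (s, X k s))) (A \<times> B)"
      using AB by (simp add: emeasure_distr emeasure_eq_measure ennreal_mult'' Int_absorb2)
  qed (auto intro: sigma_finite_measure.intro F.sigma_finite_measure D.sigma_finite_measure)
  then show "distr M (?F \<Otimes>\<^sub>M D) (\<lambda>s. (s, X k s)) = distr M ?F ?I \<Otimes>\<^sub>M distr M D (X k)" by simp
qed

text \<open>
  Integrability of \<open>G\<close> is not assumed: a Bochner integral of a non-integrable function is \<open>0\<close>.
\<close>

lemma
  fixes X :: "nat \<Rightarrow> 'a \<Rightarrow> 'd"
  assumes ind: "indep_vars (\<lambda>_. D) X {..<K}" and k: "k < K" and law: "distr M D (X k) = D"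
    and D: "prob_space D"
  shows nn_integral_history: "\<And>G. G \<in> borel_measurable (history M D X k \<Otimes>\<^sub>M D) \<Longrightarrow>
      (\<integral>\<^sup>+s. G (s, X k s) \<partial>M) = (\<integral>\<^sup>+s. (\<integral>\<^sup>+d. G (s, d) \<partial>D) \<partial>M)"
    and integral_history_eq_0: "\<And>G :: 'a \<times> 'd \<Rightarrow> real. G \<in> borel_measurable (history M D X k \<Otimes>\<^sub>M D) \<Longrightarrow>
      (\<And>s. s \<in> space M \<Longrightarrow> (\<integral>d. G (s, d) \<partial>D) = 0) \<Longrightarrow> (\<integral>s. G (s, X k s) \<partial>M) = 0"
proof -
  let ?H = "history M D X k" and ?I = "\<lambda>s. s"
  have id[measurable]: "?I \<in> measurable M ?H" and X[measurable]: "X k \<in> measurable M D"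
    using distr_history(1)[OF ind k] ind k by (auto simp: indep_vars_def)
  interpret D: prob_space D by fact
  interpret H: prob_space "distr M ?H ?I" by (rule prob_space_distr) (rule id)
  interpret HD: pair_sigma_finite "distr M ?H ?I" D ..
  have eq: "distr M (?H \<Otimes>\<^sub>M D) (\<lambda>s. (s, X k s)) = distr M ?H ?I \<Otimes>\<^sub>M D"
    using distr_history(2)[OF ind k] law by simp
  show "(\<integral>\<^sup>+s. G (s, X k s) \<partial>M) = (\<integral>\<^sup>+s. (\<integral>\<^sup>+d. G (s, d) \<partial>D) \<partial>M)"
    if G[measurable]: "G \<in> borel_measurable (?H \<Otimes>\<^sub>M D)" for G
  proof -
    have "(\<integral>\<^sup>+s. G (s, X k s) \<partial>M) = integral\<^sup>N (distr M (?H \<Otimes>\<^sub>M D) (\<lambda>s. (s, X k s))) G"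
      by (subst nn_integral_distr) auto
    also have "\<dots> = (\<integral>\<^sup>+s. (\<integral>\<^sup>+d. G (s, d) \<partial>D) \<partial>distr M ?H ?I)"
      unfolding eq by (subst D.nn_integral_fst[symmetric]) (auto cong: measurable_cong_sets)
    also have "\<dots> = (\<integral>\<^sup>+s. (\<integral>\<^sup>+d. G (s, d) \<partial>D) \<partial>M)"
      by (subst nn_integral_distr) auto
    finally show ?thesis .
  qed
  show "(\<integral>s. G (s, X k s) \<partial>M) = 0"
    if G[measurable]: "G \<in> borel_measurable (?H \<Otimes>\<^sub>M D)"
      and z: "\<And>s. s \<in> space M \<Longrightarrow> (\<integral>d. G (s, d) \<partial>D) = 0" for G :: "'a \<times> 'd \<Rightarrow> real"
  proof -
    have 1: "(\<integral>s. G (s, X k s) \<partial>M) = integral\<^sup>L (distr M ?H ?I \<Otimes>\<^sub>M D) G"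
      unfolding eq[symmetric] by (subst integral_distr) auto
    show ?thesis
    proof (cases "integrable (distr M ?H ?I \<Otimes>\<^sub>M D) G")
      case True
      have "integral\<^sup>L (distr M ?H ?I \<Otimes>\<^sub>M D) G = (\<integral>s. (\<integral>d. G (s, d) \<partial>D) \<partial>distr M ?H ?I)"
        using HD.integral_fst'[OF True] by simp
      also have "\<dots> = (\<integral>s. 0 \<partial>distr M ?H ?I)"
        by (rule Bochner_Integration.integral_cong) (auto simp: z)
      finally show ?thesis using 1 by simp
    qed (simp add: 1 not_integrable_integral_eq)
  qed
qed

end

section \<open>Moments under the law of one draw\<close>

lemma prob_space_draw_law:
  assumes "M \<ge> 1" "prob_space N"
  shows "prob_space (draw_law M N \<tau>)"
proof -
  interpret U: prob_space "uniform_count_measure {1..M}"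
    using assms by (intro prob_space_uniform_count_measure) auto
  interpret N: prob_space N by fact
  interpret NB: pair_prob_space N "measure_pmf (bernoulli_pmf (1 - \<tau>))" ..
  interpret UNB: pair_prob_space "uniform_count_measure {1..M}" "N \<Otimes>\<^sub>M measure_pmf (bernoulli_pmf (1 - \<tau>))" ..
  show ?thesis unfolding draw_law_def by (rule UNB.prob_space_axioms)
qed

text \<open>The coin is independent of the index and of the quantization, so it is integrated
  innermost with those two fixed, and its centred version has mean 0. \<open>g\<close> can be
  arbitrary because a non-integrable integrand has Bochner integral 0 by convention.\<close>

lemma integral_draw_law_coin:
  fixes g :: "nat \<Rightarrow> 'q \<Rightarrow> real"
  assumes M: "M \<ge> 1" and N: "prob_space N" and \<tau>: "0 \<le> \<tau>" "\<tau> \<le> 1"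
  shows "(\<integral>d. (of_bool (snd (snd d)) - (1 - \<tau>)) * g (fst d) (fst (snd d)) \<partial>draw_law M N \<tau>) = 0"
proof -
  let ?B = "measure_pmf (bernoulli_pmf (1 - \<tau>))" and ?U = "uniform_count_measure {1..M}"
  interpret U: prob_space ?U
    using M by (intro prob_space_uniform_count_measure) auto
  interpret N: prob_space N by fact
  interpret NB: pair_prob_space N ?B ..
  interpret UNB: pair_prob_space ?U "N \<Otimes>\<^sub>M ?B" ..
  define f where "f = (\<lambda>d. (of_bool (snd (snd d)) - (1 - \<tau>)) * g (fst d) (fst (snd d)))"
  have in0: "(\<integral>e. f (m, e) \<partial>(N \<Otimes>\<^sub>M ?B)) = 0" for m
  proof (cases "integrable (N \<Otimes>\<^sub>M ?B) (\<lambda>e. f (m, e))")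
    case True
    have "(\<integral>c. f (m, x, c) \<partial>?B) = 0" for x
      using \<tau> by (simp add: f_def integral_bernoulli_pmf algebra_simps)
    then show ?thesis using NB.integral_fst'[OF True] by simp
  qed (simp add: not_integrable_integral_eq)
  have "(\<integral>d. f d \<partial>(?U \<Otimes>\<^sub>M (N \<Otimes>\<^sub>M ?B))) = 0"
  proof (cases "integrable (?U \<Otimes>\<^sub>M (N \<Otimes>\<^sub>M ?B)) f")
    case True
    then show ?thesis using UNB.integral_fst'[OF True] in0 by simp
  qed (simp add: not_integrable_integral_eq)
  then show ?thesis by (simp add: f_def draw_law_def)
qed

lemma quantization_section_measurable:
  assumes "quantization N Q \<omega>"
  shows "(\<lambda>x. Q x y) \<in> borel_measurable N"
proof -
  have "(\<lambda>(x, y). Q x y) \<in> borel_measurable (N \<Otimes>\<^sub>M borel)" using assms by (auto simp: quantization_def)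
  from measurable_compose[OF _ this, of "\<lambda>x. (x, y)" N] show ?thesis by simp
qed

text \<open>Two unbiasedness steps: for a fixed index the quantization has mean \<open>x m\<close>,
  and the uniform index averages these means. The non-integrable case is again 0 by
  convention.\<close>

lemma integral_draw_law_quantization:
  assumes M: "M \<ge> 1" and Q: "quantization N Q \<omega>"
  shows "(\<integral>d. ((1 / real M) *\<^sub>R (\<Sum>m=1..M. x m) - Q (fst (snd d)) (x (fst d))) \<bullet> v \<partial>draw_law M N \<tau>) = 0"
proof -
  let ?B = "measure_pmf (bernoulli_pmf (1 - \<tau>))" and ?U = "uniform_count_measure {1..M}"
  interpret U: prob_space ?U
    using M by (intro prob_space_uniform_count_measure) auto
  interpret N: prob_space N using Q by (simp add: quantization_def)
  interpret NB: pair_prob_space N ?B ..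
  interpret UNB: pair_prob_space ?U "N \<Otimes>\<^sub>M ?B" ..
  define a where "a = (1 / real M) *\<^sub>R (\<Sum>m=1..M. x m)"
  define f where "f = (\<lambda>d::nat \<times> 'a \<times> bool. (a - Q (fst (snd d)) (x (fst d))) \<bullet> v)"
  have in0: "(\<integral>e. f (m, e) \<partial>(N \<Otimes>\<^sub>M ?B)) = (a - x m) \<bullet> v" for m
  proof -
    have Qm: "has_bochner_integral N (\<lambda>\<xi>. Q \<xi> (x m)) (x m)" using Q by (simp add: quantization_def)
    have "(\<integral>e. f (m, e) \<partial>(N \<Otimes>\<^sub>M ?B)) = (\<integral>\<xi>. (a - Q \<xi> (x m)) \<bullet> v \<partial>distr (N \<Otimes>\<^sub>M ?B) N fst)"
      unfolding f_def using quantization_section_measurable[OF Q]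
      by (subst integral_distr) auto
    also have "\<dots> = (\<integral>\<xi>. (a - Q \<xi> (x m)) \<bullet> v \<partial>N)" by (simp add: prob_space.distr_pair_fst[OF prob_space_measure_pmf])
    also have "\<dots> = (a - x m) \<bullet> v"
      using Qm by (subst integral_inner_left) (auto simp: has_bochner_integral_iff N.prob_space)
    finally show ?thesis .
  qed
  have "(\<integral>d. f d \<partial>(?U \<Otimes>\<^sub>M (N \<Otimes>\<^sub>M ?B))) = 0"
  proof (cases "integrable (?U \<Otimes>\<^sub>M (N \<Otimes>\<^sub>M ?B)) f")
    case True
    have "(\<integral>d. f d \<partial>(?U \<Otimes>\<^sub>M (N \<Otimes>\<^sub>M ?B))) = (\<integral>m. (a - x m) \<bullet> v \<partial>?U)"
      using UNB.integral_fst'[OF True] in0 by simp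
    also have "\<dots> = (\<Sum>m=1..M. (a - x m) \<bullet> v) / real M"
      by (subst integral_uniform_count_measure) auto
    also have "(\<Sum>m=1..M. (a - x m) \<bullet> v) = (real M *\<^sub>R a - (\<Sum>m=1..M. x m)) \<bullet> v"
      by (simp add: inner_sum_left[symmetric] sum_subtractf sum_constant_scaleR)
    also have "\<dots> = 0" using M by (simp add: a_def)
    finally show ?thesis by simp
  qed (simp add: not_integrable_integral_eq)
  then show ?thesis by (simp add: f_def a_def draw_law_def)
qed

text \<open>A nonnegative integral is used because integrability of the squared oracle is to be
  deduced from this bound. As \<open>B\<close> dominates all indices, averaging over the index
  preserves it.\<close>

lemma nn_integral_draw_law_quantization:
  assumes M: "M \<ge> 1" and Q: "quantization N Q \<omega>" and \<omega>: "0 \<le> \<omega>"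
    and x: "\<And>m. m \<in> {1..M} \<Longrightarrow> (norm (x m))\<^sup>2 \<le> B"
  shows "(\<integral>\<^sup>+d. ennreal ((norm (Q (fst (snd d)) (x (fst d))))\<^sup>2) \<partial>draw_law M N \<tau>) \<le> ennreal (\<omega> * B)"
proof -
  let ?B = "measure_pmf (bernoulli_pmf (1 - \<tau>))" and ?U = "uniform_count_measure {1..M}"
  interpret U: prob_space ?U
    using M by (intro prob_space_uniform_count_measure) auto
  interpret N: prob_space N using Q by (simp add: quantization_def)
  interpret NB: pair_prob_space N ?B ..
  interpret UNB: pair_prob_space ?U "N \<Otimes>\<^sub>M ?B" ..
  define f where "f = (\<lambda>d::nat \<times> 'a \<times> bool. ennreal ((norm (Q (fst (snd d)) (x (fst d))))\<^sup>2))"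
  have Qm[measurable]: "(\<lambda>(\<xi>, x). Q \<xi> x) \<in> borel_measurable (N \<Otimes>\<^sub>M borel)" using Q by (simp add: quantization_def)
  have [measurable]: "x \<in> borel_measurable ?U"
    by (simp cong: measurable_cong_sets add: sets_uniform_count_measure_count_space)
  have fm: "f \<in> borel_measurable (?U \<Otimes>\<^sub>M (N \<Otimes>\<^sub>M ?B))"
  proof -
    have "(\<lambda>d::nat \<times> 'a \<times> bool. (\<lambda>(\<xi>, x). Q \<xi> x) (fst (snd d), x (fst d))) \<in> borel_measurable (?U \<Otimes>\<^sub>M (N \<Otimes>\<^sub>M ?B))"
      by measurable
    then show ?thesis unfolding f_def by simp
  qed
  have in0: "(\<integral>\<^sup>+e. f (m, e) \<partial>(N \<Otimes>\<^sub>M ?B)) = ennreal (\<omega> * (norm (x m))\<^sup>2)" for m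
  proof -
    have hb: "has_bochner_integral N (\<lambda>\<xi>. (norm (Q \<xi> (x m)))\<^sup>2) (\<omega> * (norm (x m))\<^sup>2)" using Q by (simp add: quantization_def)
    have "(\<integral>\<^sup>+e. f (m, e) \<partial>(N \<Otimes>\<^sub>M ?B)) = (\<integral>\<^sup>+\<xi>. ennreal ((norm (Q \<xi> (x m)))\<^sup>2) \<partial>distr (N \<Otimes>\<^sub>M ?B) N fst)"
      unfolding f_def using quantization_section_measurable[OF Q]
      by (subst nn_integral_distr) auto
    also have "\<dots> = (\<integral>\<^sup>+\<xi>. ennreal ((norm (Q \<xi> (x m)))\<^sup>2) \<partial>N)" by (simp add: prob_space.distr_pair_fst[OF prob_space_measure_pmf])
    also have "\<dots> = ennreal (\<omega> * (norm (x m))\<^sup>2)"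
      using hb by (subst nn_integral_eq_integral) (auto simp: has_bochner_integral_iff)
    finally show ?thesis .
  qed
  have "(\<integral>\<^sup>+d. f d \<partial>(?U \<Otimes>\<^sub>M (N \<Otimes>\<^sub>M ?B))) = (\<integral>\<^sup>+m. ennreal (\<omega> * (norm (x m))\<^sup>2) \<partial>?U)"
    using in0 by (subst NB.nn_integral_fst[OF fm, symmetric]) simp
  also have "\<dots> \<le> (\<integral>\<^sup>+m. ennreal (\<omega> * B) \<partial>?U)"
    using x \<omega> by (intro nn_integral_mono ennreal_leI mult_left_mono) (auto simp: space_uniform_count_measure)
  also have "\<dots> = ennreal (\<omega> * B)" by (simp add: U.emeasure_space_1 del: One_nat_def)
  finally show ?thesis by (simp add: f_def draw_law_def)
qed

text \<open>Integrating the expansion of \<open>|Q \<xi> e - e|^2 \<ge> 0\<close> for a unit vector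
  \<open>e\<close> gives \<open>2 - 1 \<le> \<omega>\<close>. This secures the sign of
  \<open>\<omega>\<close> in the moment bounds and under the roots of the step sizes.\<close>

lemma quantization_ge_1:
  fixes Q :: "'q \<Rightarrow> 'a::euclidean_space \<Rightarrow> 'a"
  assumes Q: "quantization N Q \<omega>"
  shows "1 \<le> \<omega>"
proof -
  interpret N: prob_space N using Q by (simp add: quantization_def)
  obtain e :: 'a where e: "e \<in> Basis" using nonempty_Basis by blast
  have 1: "has_bochner_integral N (\<lambda>\<xi>. Q \<xi> e) e" "has_bochner_integral N (\<lambda>\<xi>. (norm (Q \<xi> e))\<^sup>2) \<omega>"
    using Q e by (auto simp: quantization_def dest: spec[of _ e])
  have "(\<integral>\<xi>. 2 * (Q \<xi> e \<bullet> e) - 1 \<partial>N) \<le> (\<integral>\<xi>. (norm (Q \<xi> e))\<^sup>2 \<partial>N)"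
  proof (rule integral_mono)
    fix \<xi>
    have "0 \<le> (norm (Q \<xi> e - e))\<^sup>2" by simp
    then show "2 * (Q \<xi> e \<bullet> e) - 1 \<le> (norm (Q \<xi> e))\<^sup>2"
      using e unfolding power2_norm_eq_inner by (simp add: inner_simps inner_commute)
  qed (use 1 in \<open>auto simp: has_bochner_integral_iff\<close>)
  also have "(\<integral>\<xi>. 2 * (Q \<xi> e \<bullet> e) - 1 \<partial>N) = 1"
    using 1 e by (simp add: has_bochner_integral_iff N.prob_space)
  finally show ?thesis using 1 by (simp add: has_bochner_integral_iff)
qed

section \<open>Deterministic inequalities for averages and for one iteration\<close>

lemma convex_fun_average:
  assumes h: "convex_fun h" and "1 \<le> n" "\<And>i. i < n \<Longrightarrow> h (x i) = ereal (a i)"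
    and fin: "\<And>y. h y \<noteq> -\<infinity>"
  shows "h ((1 / real n) *\<^sub>R (\<Sum>i<n. x i)) \<le> ereal ((1 / real n) * (\<Sum>i<n. a i))"
  using assms(2,3)
proof (induction n rule: dec_induct)
  case base
  then show ?case by simp
next
  case (step n)
  define y where "y = (1 / real n) *\<^sub>R (\<Sum>i<n. x i)"
  define t where "t = 1 / (1 + real n)"
  have IH: "h y \<le> ereal ((1 / real n) * (\<Sum>i<n. a i))" unfolding y_def using step by simp
  then obtain b where b: "h y = ereal b" "b \<le> (1 / real n) * (\<Sum>i<n. a i)"
    using fin[of y] by (cases "h y") auto
  have n: "real n > 0" using step by simp
  \<comment> \<open>The last identity says that shrinking the average of \<open>n\<close> points by
    \<open>1 - t\<close> gives each of them the weight \<open>t\<close> of the new point.\<close>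
  have t1: "0 \<le> t" "t \<le> 1" "(1 - t) * (1 / real n) = t" using n by (auto simp: t_def field_simps)
  have "(1 - t) *\<^sub>R y + t *\<^sub>R x n = (1 / real (Suc n)) *\<^sub>R (\<Sum>i<Suc n. x i)"
    unfolding y_def using t1(3) by (simp add: scaleR_right_distrib) (simp add: t_def)
  then have "h ((1 / real (Suc n)) *\<^sub>R (\<Sum>i<Suc n. x i)) \<le> ereal ((1 - t) * b + t * a n)"
    using convex_fun_real[OF h b(1) step.prems[of n] t1(1,2)] by simp
  also have "(1 - t) * b + t * a n \<le> (1 - t) * ((1 / real n) * (\<Sum>i<n. a i)) + t * a n"
    using b t1 by (intro add_mono mult_left_mono) auto
  also have "(1 - t) * ((1 / real n) * (\<Sum>i<n. a i)) = t * (\<Sum>i<n. a i)"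
    unfolding mult.assoc[symmetric] t1(3) ..
  also have "t * (\<Sum>i<n. a i) + t * a n = (1 / real (Suc n)) * (\<Sum>i<Suc n. a i)"
    by (simp add: t_def add_divide_distrib)
  finally show ?case by simp
qed

text \<open>Since \<open>(x - p) / \<gamma>\<close> is a subgradient of \<open>h\<close> at
  \<open>p\<close>, the convexity clause of \<open>monotone_pair\<close> can be applied there;
  multiplication by \<open>\<gamma>\<close> gives the usual proximal inequality, strengthened by
  \<open>\<mu>h\<close>.\<close>

lemma prox_strong_ineq:
  fixes h :: "'a::euclidean_space \<Rightarrow> ereal" and x :: 'a
  assumes h: "proper_fun h" "lsc_fun h" "convex_fun h" and \<gamma>: "0 < \<gamma>"
    and mono: "monotone_pair Z F h \<mu>F \<mu>h" and Z: "{x. h x < \<infinity>} \<subseteq> Z" and u: "\<bar>h u\<bar> \<noteq> \<infinity>"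
  defines "p \<equiv> prox \<gamma> h x"
  shows "\<gamma> * (real_of_ereal (h p) - real_of_ereal (h u))
    \<le> (x - p) \<bullet> (p - u) - \<gamma> * (\<mu>h / 2 * (norm (u - p))\<^sup>2)"
proof -
  obtain a b where ab: "h p = ereal a" "h u = ereal b"
    using prox_finite[OF h \<gamma>, of x] u by (auto simp: p_def)
  then have "p \<in> Z" "u \<in> Z" using Z by auto
  moreover have "(1 / \<gamma>) *\<^sub>R (x - p) \<in> subdifferential h p"
    unfolding p_def by (rule prox_subgradient[OF h \<gamma>])
  ultimately have "h u - h p - ereal (((1 / \<gamma>) *\<^sub>R (x - p)) \<bullet> (u - p)) \<ge> ereal (\<mu>h / 2 * (norm (u - p))\<^sup>2)"
    using mono unfolding monotone_pair_def by blast
  then have "\<mu>h / 2 * (norm (u - p))\<^sup>2 \<le> b - a - ((x - p) \<bullet> (u - p)) / \<gamma>"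
    by (simp only: ab) simp
  then have "\<gamma> * (\<mu>h / 2 * (norm (u - p))\<^sup>2) \<le> \<gamma> * (b - a - ((x - p) \<bullet> (u - p)) / \<gamma>)"
    using \<gamma> by (intro mult_left_mono) auto
  also have "\<dots> = \<gamma> * (b - a) - (x - p) \<bullet> (u - p)" using \<gamma> by (simp add: right_diff_distrib)
  also have "(x - p) \<bullet> (u - p) = - ((x - p) \<bullet> (p - u))" by (simp add: inner_diff_right)
  finally show ?thesis by (simp add: ab right_diff_distrib)
qed

text \<open>The half step is tested at the full step \<open>p\<close>, and the full step at
  \<open>u\<close>, so the two differences of \<open>h\<close> add up to \<open>h y - h u\<close>.
  The operator terms combine to \<open>f + q\<close> paired with \<open>y - u\<close>, at the price
  of the error \<open>q \<bullet> (y - p)\<close>.\<close>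

lemma extragradient_step:
  fixes h :: "'a::euclidean_space \<Rightarrow> ereal"
  assumes h: "proper_fun h" "lsc_fun h" "convex_fun h" and \<gamma>: "0 < \<gamma>"
    and mono: "monotone_pair Z F h \<mu>F \<mu>h" and Z: "{x. h x < \<infinity>} \<subseteq> Z" and u: "\<bar>h u\<bar> \<noteq> \<infinity>"
    and y: "y = prox \<gamma> h (\<tau> *\<^sub>R z + (1 - \<tau>) *\<^sub>R w - \<gamma> *\<^sub>R f)"
    and p: "p = prox \<gamma> h (\<tau> *\<^sub>R z + (1 - \<tau>) *\<^sub>R w - \<gamma> *\<^sub>R q - \<gamma> *\<^sub>R f)"
  shows "2 * \<gamma> * ((f + q) \<bullet> (y - u) + real_of_ereal (h y) - real_of_ereal (h u))
      + (norm (p - u))\<^sup>2 + \<gamma> * \<mu>h * ((norm (y - p))\<^sup>2 + (norm (p - u))\<^sup>2)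
    \<le> \<tau> * (norm (z - u))\<^sup>2 + (1 - \<tau>) * (norm (w - u))\<^sup>2 - (norm (y - p))\<^sup>2
      - \<tau> * (norm (z - y))\<^sup>2 - (1 - \<tau>) * (norm (w - y))\<^sup>2 + 2 * \<gamma> * (q \<bullet> (y - p))"
proof -
  define zb where "zb = \<tau> *\<^sub>R z + (1 - \<tau>) *\<^sub>R w"
  have "\<bar>h p\<bar> \<noteq> \<infinity>" unfolding p by (rule prox_finite[OF h \<gamma>])
  then have 1: "\<gamma> * (real_of_ereal (h y) - real_of_ereal (h p))
      \<le> (zb - \<gamma> *\<^sub>R f - y) \<bullet> (y - p) - \<gamma> * (\<mu>h / 2 * (norm (p - y))\<^sup>2)"
    using prox_strong_ineq[OF h \<gamma> mono Z, of p "zb - \<gamma> *\<^sub>R f"] by (simp add: y zb_def)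
  have 2: "\<gamma> * (real_of_ereal (h p) - real_of_ereal (h u))
      \<le> (zb - \<gamma> *\<^sub>R q - \<gamma> *\<^sub>R f - p) \<bullet> (p - u) - \<gamma> * (\<mu>h / 2 * (norm (u - p))\<^sup>2)"
    using prox_strong_ineq[OF h \<gamma> mono Z u, of "zb - \<gamma> *\<^sub>R q - \<gamma> *\<^sub>R f"] by (simp add: p zb_def)
  have 3: "(zb - \<gamma> *\<^sub>R f - y) \<bullet> (y - p) + (zb - \<gamma> *\<^sub>R q - \<gamma> *\<^sub>R f - p) \<bullet> (p - u)
      = (zb - y) \<bullet> (y - p) + (zb - p) \<bullet> (p - u) - \<gamma> * ((f + q) \<bullet> (y - u)) + \<gamma> * (q \<bullet> (y - p))"
    by (simp add: inner_simps algebra_simps)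
  \<comment> \<open>Because the weights of \<open>z\<close> and \<open>w\<close> sum to 1,
    \<open>|zb - u|^2\<close> and \<open>|zb - y|^2\<close> contain the same correction
    \<open>\<tau> * (1 - \<tau>) * |z - w|^2\<close>, which cancels in their difference.\<close>
  have 4: "2 * ((zb - y) \<bullet> (y - p)) + 2 * ((zb - p) \<bullet> (p - u))
      = \<tau> * (norm (z - u))\<^sup>2 + (1 - \<tau>) * (norm (w - u))\<^sup>2 - (norm (y - p))\<^sup>2
      - \<tau> * (norm (z - y))\<^sup>2 - (1 - \<tau>) * (norm (w - y))\<^sup>2 - (norm (p - u))\<^sup>2"
    unfolding zb_def power2_norm_eq_inner
    by (simp add: inner_add_left inner_add_right inner_diff_left inner_diff_right inner_commute algebra_simps)
  have 5: "2 * \<gamma> * ((f + q) \<bullet> (y - u) + real_of_ereal (h y) - real_of_ereal (h u))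
    = 2 * (\<gamma> * ((f + q) \<bullet> (y - u))) + 2 * (\<gamma> * (real_of_ereal (h y) - real_of_ereal (h p)))
      + 2 * (\<gamma> * (real_of_ereal (h p) - real_of_ereal (h u)))"
    by (simp add: algebra_simps)
  have 6: "\<gamma> * \<mu>h * ((norm (y - p))\<^sup>2 + (norm (p - u))\<^sup>2)
      = 2 * (\<gamma> * (\<mu>h / 2 * (norm (p - y))\<^sup>2)) + 2 * (\<gamma> * (\<mu>h / 2 * (norm (u - p))\<^sup>2))"
    by (simp add: norm_minus_commute algebra_simps)
  show ?thesis using 1 2 3 4 unfolding 5 6 by linarith
qed

section \<open>The quantized extragradient method\<close>

lemma measurable_cong_imp:
  "f \<in> measurable A B \<Longrightarrow> (\<And>s. s \<in> space A \<Longrightarrow> g s = f s) \<Longrightarrow> g \<in> measurable A B"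
  using measurable_cong[of A f g B] by simp

text \<open>The step size is only required to be positive here. Its upper bounds enter with the
  individual rates, so both cases share the measurability and integrability results.\<close>

locale quantized_extragradient = prob_space P
  for P :: "'w measure" +
  fixes N :: "'q measure"
    and Q :: "'q \<Rightarrow> 'a::euclidean_space \<Rightarrow> 'a"
    and F :: "'a \<Rightarrow> 'a" and Fm :: "nat \<Rightarrow> 'a \<Rightarrow> 'a" and h :: "'a \<Rightarrow> ereal"
    and Z :: "'a set" and z0 :: 'a
    and \<omega> \<tau> \<gamma> L D :: real and M K :: nat
    and idx :: "nat \<Rightarrow> 'w \<Rightarrow> nat" and \<xi> :: "nat \<Rightarrow> 'w \<Rightarrow> 'q" and coin :: "nat \<Rightarrow> 'w \<Rightarrow> bool"
    and z w zbar zhalf :: "nat \<Rightarrow> 'w \<Rightarrow> 'a"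
  assumes h: "proper_fun h" "lsc_fun h" "convex_fun h"
    and Z: "closed Z" "{x. h x < \<infinity>} \<subseteq> Z"
    and \<tau>: "0 \<le> \<tau>" "\<tau> < 1"
    and M: "M \<ge> 1"
    and F: "\<And>x. F x = (1 / real M) *\<^sub>R (\<Sum>m=1..M. Fm m x)"
    and Fm_measurable: "\<And>m. m \<in> {1..M} \<Longrightarrow> Fm m \<in> borel_measurable (restrict_space borel Z)"
    and F_lipschitz: "boundedly_lipschitz Z L D F"
    and Fm_lipschitz: "\<And>m. m \<in> {1..M} \<Longrightarrow> boundedly_lipschitz Z L D (Fm m)"
    and Q: "quantization N Q \<omega>"
    and draws_indep: "indep_vars (\<lambda>_. draw_law M N \<tau>) (\<lambda>k s. (idx k s, \<xi> k s, coin k s)) {..<K}"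
    and draws_law: "\<And>k. k < K \<Longrightarrow>
           distr P (draw_law M N \<tau>) (\<lambda>s. (idx k s, \<xi> k s, coin k s)) = draw_law M N \<tau>"
    and z0: "z0 \<in> Z"
    and init: "\<And>s. s \<in> space P \<Longrightarrow> z 0 s = z0" "\<And>s. s \<in> space P \<Longrightarrow> w 0 s = z0"
    and zbar: "\<And>k s. k < K \<Longrightarrow> s \<in> space P \<Longrightarrow>
           zbar k s = \<tau> *\<^sub>R z k s + (1 - \<tau>) *\<^sub>R w k s"
    and zhalf: "\<And>k s. k < K \<Longrightarrow> s \<in> space P \<Longrightarrow>
           zhalf k s = prox \<gamma> h (zbar k s - \<gamma> *\<^sub>R F (w k s))"
    and z_step: "\<And>k s. k < K \<Longrightarrow> s \<in> space P \<Longrightarrow>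
           z (k + 1) s = prox \<gamma> h (zbar k s
             - \<gamma> *\<^sub>R Q (\<xi> k s) (Fm (idx k s) (zhalf k s) - Fm (idx k s) (w k s))
             - \<gamma> *\<^sub>R F (w k s))"
    and w_step: "\<And>k s. k < K \<Longrightarrow> s \<in> space P \<Longrightarrow>
           w (k + 1) s = (if coin k s then z (k + 1) s else w k s)"
    and \<gamma>: "0 < \<gamma>"
begin

abbreviation "draw \<equiv> draw_law M N \<tau>"
abbreviation "X k s \<equiv> (idx k s, \<xi> k s, coin k s)"
abbreviation "\<F> k \<equiv> history P draw X k"
abbreviation "borelZ \<equiv> restrict_space borel Z"

text \<open>These satisfy \<open>F (w k s) + q k s = F (zhalf k s) - \<Delta> k s\<close>: the
  quantized difference corrects the operator at the reference point into an unbiased estimate at the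
  half step, and \<open>\<Delta>\<close> merges the error of quantization with that of sampling the
  index.\<close>

definition q :: "nat \<Rightarrow> 'w \<Rightarrow> 'a" where
  "q k s = Q (\<xi> k s) (Fm (idx k s) (zhalf k s) - Fm (idx k s) (w k s))"
definition \<Delta> :: "nat \<Rightarrow> 'w \<Rightarrow> 'a" where
  "\<Delta> k s = F (zhalf k s) - F (w k s) - q k s"
definition b :: "nat \<Rightarrow> 'w \<Rightarrow> real" where
  "b k s = of_bool (coin k s) - (1 - \<tau>)"

lemma \<omega>: "1 \<le> \<omega>" by (rule quantization_ge_1[OF Q])

lemma prob_space_N: "prob_space N" using Q by (simp add: quantization_def)

lemma prob_space_draw: "prob_space draw" by (rule prob_space_draw_law[OF M prob_space_N])

lemma X_measurable: "k < K \<Longrightarrow> X k \<in> measurable P draw"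
  using draws_indep by (auto simp: indep_vars_def)

lemma X_space: "k < K \<Longrightarrow> X k \<in> space P \<rightarrow> space draw"
  using measurable_space[OF X_measurable] by blast

lemma draw_components:
  "fst \<in> measurable draw (uniform_count_measure {1..M})"
  "(\<lambda>d. fst (snd d)) \<in> measurable draw N"
  "(\<lambda>d. of_bool (snd (snd d)) :: real) \<in> borel_measurable draw"
  "Measurable.pred draw (\<lambda>d. snd (snd d))"
proof -
  show "fst \<in> measurable draw (uniform_count_measure {1..M})" "(\<lambda>d. fst (snd d)) \<in> measurable draw N"
    unfolding draw_law_def by measurable
  have "(\<lambda>d. snd (snd d)) \<in> measurable draw (measure_pmf (bernoulli_pmf (1 - \<tau>)))"
    unfolding draw_law_def by measurable
  then show 1: "Measurable.pred draw (\<lambda>d. snd (snd d))" by (simp cong: measurable_cong_sets)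
  then show "(\<lambda>d. of_bool (snd (snd d)) :: real) \<in> borel_measurable draw" by measurable
qed

section \<open>Measurability of the iterates\<close>

lemma prox_in_Z: "prox \<gamma> h x \<in> Z"
  using prox_finite[OF h \<gamma>, of x] Z(2) by (cases "h (prox \<gamma> h x)") auto

text \<open>Operators that are Lipschitz only up to \<open>D\<close> may jump, and their
  measurability is given on \<open>Z\<close> alone. Hence the iterates are followed as maps into
  \<open>borelZ\<close>, and the proximal map, which lands in \<open>Z\<close>, must be measurable
  into that space.\<close>

lemma prox_measurable: "prox \<gamma> h \<in> measurable borel borelZ"
proof (rule measurable_restrict_space2)
  have "1-lipschitz_on UNIV (prox \<gamma> h)"
    by (rule lipschitz_onI) (simp_all add: dist_norm prox_nonexpansive[OF h \<gamma>])
  then have "continuous_on UNIV (prox \<gamma> h)" by (rule lipschitz_on_continuous_on)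
  then show "prox \<gamma> h \<in> borel_measurable borel" by (rule borel_measurable_continuous_onI)
qed (use prox_in_Z in auto)

lemma F_measurable: "F \<in> borel_measurable borelZ"
proof -
  have "(\<lambda>x. \<Sum>m=1..M. Fm m x) \<in> borel_measurable borelZ"
    by (rule borel_measurable_sum) (rule Fm_measurable)
  then have "(\<lambda>x. (1 / real M) *\<^sub>R (\<Sum>m=1..M. Fm m x)) \<in> borel_measurable borelZ"
    by (rule borel_measurable_scaleR[OF borel_measurable_const])
  then show ?thesis by (simp only: F[symmetric])
qed

lemma borelZ_borel: "f \<in> measurable A borelZ \<Longrightarrow> f \<in> borel_measurable A"
  by (simp add: measurable_restrict_space2_iff)

text \<open>The index is a random argument of \<open>Fm\<close>. Over a countable discrete index
  space, measurability for each index implies joint measurability in index and point.\<close>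

lemma oracle_measurable:
  assumes a: "a \<in> measurable A (uniform_count_measure {1..M})" and x: "x \<in> measurable A N"
    and y: "y \<in> measurable A borelZ" and v: "v \<in> measurable A borelZ"
  shows "(\<lambda>s. Q (x s) (Fm (a s) (y s) - Fm (a s) (v s))) \<in> borel_measurable A"
proof -
  have "(\<lambda>(m, x). Fm m x) \<in> borel_measurable (count_space {1..M} \<Otimes>\<^sub>M borelZ)"
    by (rule measurable_pair_measure_countable1) (use Fm_measurable in auto)
  then have Fp: "(\<lambda>(m, x). Fm m x) \<in> borel_measurable (uniform_count_measure {1..M} \<Otimes>\<^sub>M borelZ)"
    by (simp cong: measurable_cong_sets sets_pair_measure_cong add: sets_uniform_count_measure_count_space)
  have 1: "(\<lambda>s. Fm (a s) (u s)) \<in> borel_measurable A" if "u \<in> measurable A borelZ" for u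
    using measurable_compose[OF measurable_Pair[OF a that] Fp] by simp
  have "(\<lambda>(\<xi>, x). Q \<xi> x) \<in> borel_measurable (N \<Otimes>\<^sub>M borel)" using Q by (simp add: quantization_def)
  from measurable_compose[OF measurable_Pair[OF x borel_measurable_diff[OF 1[OF y] 1[OF v]]] this]
  show ?thesis by simp
qed

lemma iterates_in_Z:
  "s \<in> space P \<Longrightarrow> k \<le> K \<Longrightarrow> z k s \<in> Z \<and> w k s \<in> Z"
proof (induction k)
  case (Suc k)
  then have "z (Suc k) s \<in> Z" using z_step[of k s] prox_in_Z by simp
  with Suc show ?case using w_step[of k s] by simp
qed (simp add: init z0)

lemma zhalf_in_Z: "s \<in> space P \<Longrightarrow> k < K \<Longrightarrow> zhalf k s \<in> Z"
  by (simp only: zhalf prox_in_Z)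

lemma history_mono:
  "f \<in> measurable (\<F> k) A \<Longrightarrow> k \<le> l \<Longrightarrow> l \<le> K \<Longrightarrow> f \<in> measurable (\<F> l) A"
  by (rule measurable_history_mono, assumption, assumption, rule X_space, simp)

lemma history_P: "f \<in> measurable (\<F> k) A \<Longrightarrow> k \<le> K \<Longrightarrow> f \<in> measurable P A"
  by (rule measurable_history_imp_measurable, assumption, rule X_measurable, simp)

lemma X_history: "k < l \<Longrightarrow> l \<le> K \<Longrightarrow> X k \<in> measurable (\<F> l) draw"
  by (rule measurable_history_self, assumption, rule X_space, simp)

lemma half_step_measurable:
  assumes "k < K" "z k \<in> measurable (\<F> k) borelZ" "w k \<in> measurable (\<F> k) borelZ"
  shows "zbar k \<in> borel_measurable (\<F> k)" "zhalf k \<in> measurable (\<F> k) borelZ"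
proof -
  note [measurable] = assms(2,3)[THEN borelZ_borel] measurable_compose[OF assms(3) F_measurable] prox_measurable
  have "(\<lambda>s. \<tau> *\<^sub>R z k s + (1 - \<tau>) *\<^sub>R w k s) \<in> borel_measurable (\<F> k)" by measurable
  then show [measurable]: "zbar k \<in> borel_measurable (\<F> k)"
    by (rule measurable_cong_imp) (simp add: zbar assms(1))
  have "(\<lambda>s. prox \<gamma> h (zbar k s - \<gamma> *\<^sub>R F (w k s))) \<in> measurable (\<F> k) borelZ" by measurable
  then show "zhalf k \<in> measurable (\<F> k) borelZ"
    by (rule measurable_cong_imp) (simp add: zhalf assms(1))
qed

text \<open>\<open>\<F> k\<close> knows only the draws before step \<open>k\<close>, so the half
  step is determined before draw \<open>k\<close> is made, whereas \<open>z (Suc k)\<close> and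
  \<open>w (Suc k)\<close> belong to the next history. This shift lets the past be frozen in the
  moment computations.\<close>

lemma iterates_measurable: "k \<le> K \<Longrightarrow> z k \<in> measurable (\<F> k) borelZ \<and> w k \<in> measurable (\<F> k) borelZ"
proof (induction k)
  case 0
  have "(\<lambda>_. z0) \<in> measurable (\<F> 0) borelZ" using z0 by (simp add: space_restrict_space)
  from measurable_cong_imp[OF this] show ?case by (simp add: init)
next
  case (Suc k)
  then have k: "k < K" and IH: "z k \<in> measurable (\<F> k) borelZ" "w k \<in> measurable (\<F> k) borelZ" by auto
  have up: "f \<in> measurable (\<F> (Suc k)) A" if "f \<in> measurable (\<F> k) A" for f and A :: "'c measure"
    by (rule history_mono[OF that]) (use k in simp_all)
  note half = half_step_measurable[OF k IH]
  have Xk: "X k \<in> measurable (\<F> (Suc k)) draw" by (rule X_history) (use k in simp_all)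
  note [measurable] = up[OF half(1)] prox_measurable up[OF measurable_compose[OF IH(2) F_measurable]]
    up[OF IH(2)]
  have qm[measurable]: "(\<lambda>s. Q (\<xi> k s) (Fm (idx k s) (zhalf k s) - Fm (idx k s) (w k s))) \<in> borel_measurable (\<F> (Suc k))"
    using oracle_measurable[OF measurable_compose[OF Xk draw_components(1)]
      measurable_compose[OF Xk draw_components(2)] up[OF half(2)] up[OF IH(2)]] by simp
  have [measurable]: "Measurable.pred (\<F> (Suc k)) (\<lambda>s. coin k s)"
    using measurable_compose[OF Xk draw_components(4)] by simp
  have "(\<lambda>s. prox \<gamma> h (zbar k s
             - \<gamma> *\<^sub>R Q (\<xi> k s) (Fm (idx k s) (zhalf k s) - Fm (idx k s) (w k s))
             - \<gamma> *\<^sub>R F (w k s))) \<in> measurable (\<F> (Suc k)) borelZ"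
    by measurable
  then have zS[measurable]: "z (Suc k) \<in> measurable (\<F> (Suc k)) borelZ"
    by (rule measurable_cong_imp) (simp add: z_step[OF k, simplified])
  have "(\<lambda>s. if coin k s then z (Suc k) s else w k s) \<in> measurable (\<F> (Suc k)) borelZ"
    by measurable
  then have "w (Suc k) \<in> measurable (\<F> (Suc k)) borelZ"
    by (rule measurable_cong_imp) (simp add: w_step[OF k, simplified])
  with zS show ?case by simp
qed

lemma adapted:
  assumes k: "k < K"
  shows "z k \<in> measurable (\<F> k) borelZ" "w k \<in> measurable (\<F> k) borelZ"
    "zbar k \<in> borel_measurable (\<F> k)" "zhalf k \<in> measurable (\<F> k) borelZ"
    "z k \<in> borel_measurable (\<F> k)" "w k \<in> borel_measurable (\<F> k)" "zhalf k \<in> borel_measurable (\<F> k)"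
    "(\<lambda>s. F (w k s)) \<in> borel_measurable (\<F> k)" "(\<lambda>s. F (zhalf k s)) \<in> borel_measurable (\<F> k)"
proof -
  show 1: "z k \<in> measurable (\<F> k) borelZ" "w k \<in> measurable (\<F> k) borelZ"
    using iterates_measurable[OF less_imp_le[OF k]] by simp_all
  show 2: "zbar k \<in> borel_measurable (\<F> k)" "zhalf k \<in> measurable (\<F> k) borelZ"
    by (rule half_step_measurable[OF k 1])+
  show "z k \<in> borel_measurable (\<F> k)" "w k \<in> borel_measurable (\<F> k)" "zhalf k \<in> borel_measurable (\<F> k)"
    "(\<lambda>s. F (w k s)) \<in> borel_measurable (\<F> k)" "(\<lambda>s. F (zhalf k s)) \<in> borel_measurable (\<F> k)"
    by (rule borelZ_borel 1 2 measurable_compose[OF 1(2) F_measurable] measurable_compose[OF 2(2) F_measurable])+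
qed

lemma innovations_measurable:
  assumes k: "k < l" "l \<le> K"
  shows "q k \<in> borel_measurable (\<F> l)" "\<Delta> k \<in> borel_measurable (\<F> l)" "b k \<in> borel_measurable (\<F> l)"
proof -
  have kK: "k < K" using k by simp
  have Xk: "X k \<in> measurable (\<F> l) draw" by (rule X_history[OF k])
  note up = history_mono[OF _ less_imp_le[OF k(1)] k(2)]
  note ad = adapted[OF kK]
  show q[measurable]: "q k \<in> borel_measurable (\<F> l)"
    unfolding q_def[abs_def]
    using oracle_measurable[OF measurable_compose[OF Xk draw_components(1)]
      measurable_compose[OF Xk draw_components(2)] up[OF ad(4)] up[OF ad(2)]] by simp
  note [measurable] = up[OF ad(8)] up[OF ad(9)]
  show "\<Delta> k \<in> borel_measurable (\<F> l)" unfolding \<Delta>_def[abs_def] by measurable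
  have [measurable]: "(\<lambda>s. of_bool (coin k s) :: real) \<in> borel_measurable (\<F> l)"
    using measurable_compose[OF Xk draw_components(3)] by simp
  show "b k \<in> borel_measurable (\<F> l)" unfolding b_def[abs_def] by measurable
qed

section \<open>Conditional moments of the oracle and of the coin\<close>

lemma joint_oracle_measurable:
  assumes k: "k < K"
  shows "(\<lambda>(s, d). Q (fst (snd d)) (Fm (fst d) (zhalf k s) - Fm (fst d) (w k s)))
    \<in> borel_measurable (\<F> k \<Otimes>\<^sub>M draw)"
proof -
  have s: "fst \<in> measurable (\<F> k \<Otimes>\<^sub>M draw) (\<F> k)" and d: "snd \<in> measurable (\<F> k \<Otimes>\<^sub>M draw) draw" by auto
  show ?thesis
    using oracle_measurable[OF measurable_compose[OF d draw_components(1)]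
      measurable_compose[OF d draw_components(2)] measurable_compose[OF s adapted(4)[OF k]]
      measurable_compose[OF s adapted(2)[OF k]]]
    by (simp add: case_prod_beta')
qed

text \<open>Integrability of \<open>|q k s|^2\<close> is part of the claim, hence the detour through
  nonnegative integrals. With the past frozen, every index gives a difference of squared norm at
  most \<open>r s\<close>, so the draw contributes at most \<open>\<omega> * r s\<close>.\<close>

lemma oracle_second_moment:
  assumes k: "k < K" and y: "sq_integrable P (zhalf k)" and w: "sq_integrable P (w k)"
  shows "sq_integrable P (q k)"
    and "(\<integral>s. (norm (q k s))\<^sup>2 \<partial>P) \<le> \<omega> * (L\<^sup>2 * (\<integral>s. (norm (zhalf k s - w k s))\<^sup>2 \<partial>P) + D\<^sup>2)"
proof -
  define r where "r = (\<lambda>s. L\<^sup>2 * (norm (zhalf k s - w k s))\<^sup>2 + D\<^sup>2)"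
  have int: "integrable P (\<lambda>s. (norm (zhalf k s - w k s))\<^sup>2)"
    using sq_integrable_diff[OF y w] by (simp add: sq_integrable_def)
  then have r: "integrable P (\<lambda>s. \<omega> * r s)" unfolding r_def by simp
  define G where "G = (\<lambda>(s, d :: nat \<times> 'q \<times> bool). ennreal ((norm (Q (fst (snd d)) (Fm (fst d) (zhalf k s) - Fm (fst d) (w k s))))\<^sup>2))"
  have qm: "q k \<in> borel_measurable P"
    by (rule history_P[OF innovations_measurable(1)[OF lessI]]) (use k in simp_all)
  have G: "G \<in> borel_measurable (\<F> k \<Otimes>\<^sub>M draw)"
    using joint_oracle_measurable[OF k] unfolding G_def case_prod_beta' by measurable
  have "(\<integral>\<^sup>+s. ennreal ((norm (q k s))\<^sup>2) \<partial>P) = (\<integral>\<^sup>+s. G (s, X k s) \<partial>P)" by (simp add: q_def G_def)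
  also have "\<dots> = (\<integral>\<^sup>+s. (\<integral>\<^sup>+d. G (s, d) \<partial>draw) \<partial>P)"
    by (rule nn_integral_history[OF draws_indep k draws_law[OF k] prob_space_draw G])
  also have "\<dots> \<le> (\<integral>\<^sup>+s. ennreal (\<omega> * r s) \<partial>P)"
  proof (rule nn_integral_mono)
    fix s assume s: "s \<in> space P"
    have "(norm (Fm m (zhalf k s) - Fm m (w k s)))\<^sup>2 \<le> r s" if "m \<in> {1..M}" for m
      using Fm_lipschitz[OF that] zhalf_in_Z[OF s k] iterates_in_Z[OF s, of k] k
      unfolding boundedly_lipschitz_def r_def by auto
    then show "(\<integral>\<^sup>+d. G (s, d) \<partial>draw) \<le> ennreal (\<omega> * r s)"
      using nn_integral_draw_law_quantization[OF M Q, of "\<lambda>m. Fm m (zhalf k s) - Fm m (w k s)" "r s"] \<omega>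
      by (simp add: G_def)
  qed
  also have "\<dots> = ennreal (\<integral>s. \<omega> * r s \<partial>P)"
    using \<omega> by (intro nn_integral_eq_integral r) (simp add: r_def)
  finally have le: "(\<integral>\<^sup>+s. ennreal ((norm (q k s))\<^sup>2) \<partial>P) \<le> ennreal (\<integral>s. \<omega> * r s \<partial>P)" .
  have qi: "integrable P (\<lambda>s. (norm (q k s))\<^sup>2)"
    using le qm by (intro integrableI_bounded) (auto intro: le_less_trans)
  with qm show "sq_integrable P (q k)" by (simp add: sq_integrable_def)
  have "0 \<le> (\<integral>s. \<omega> * r s \<partial>P)" using \<omega> by (intro integral_nonneg_AE) (simp add: r_def)
  then have "(\<integral>s. (norm (q k s))\<^sup>2 \<partial>P) \<le> (\<integral>s. \<omega> * r s \<partial>P)"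
    using le qi by (simp add: nn_integral_eq_integral)
  also have "\<dots> = \<omega> * (L\<^sup>2 * (\<integral>s. (norm (zhalf k s - w k s))\<^sup>2 \<partial>P) + D\<^sup>2)"
    using int by (simp add: r_def prob_space)
  finally show "(\<integral>s. (norm (q k s))\<^sup>2 \<partial>P) \<le> \<omega> * (L\<^sup>2 * (\<integral>s. (norm (zhalf k s - w k s))\<^sup>2 \<partial>P) + D\<^sup>2)" .
qed

text \<open>Freezing the past fixes \<open>zhalf k s\<close>, \<open>w k s\<close> and
  \<open>V s\<close>, and the mean over the draw is 0. Any weight known before draw \<open>k\<close>
  is therefore admissible.\<close>

lemma \<Delta>_mean_zero:
  assumes k: "k < K" and V: "V \<in> borel_measurable (\<F> k)"
  shows "(\<integral>s. \<Delta> k s \<bullet> V s \<partial>P) = 0"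
proof -
  define G where "G = (\<lambda>(s, d :: nat \<times> 'q \<times> bool). (F (zhalf k s) - F (w k s)
     - Q (fst (snd d)) (Fm (fst d) (zhalf k s) - Fm (fst d) (w k s))) \<bullet> V s)"
  have s: "fst \<in> measurable (\<F> k \<Otimes>\<^sub>M draw) (\<F> k)" by auto
  note [measurable] = joint_oracle_measurable[OF k, unfolded case_prod_beta'] measurable_compose[OF s V]
     measurable_compose[OF s adapted(8)[OF k]] measurable_compose[OF s adapted(9)[OF k]]
  have "(\<integral>s. G (s, X k s) \<partial>P) = 0"
  proof (rule integral_history_eq_0[OF draws_indep k draws_law[OF k] prob_space_draw])
    show "G \<in> borel_measurable (\<F> k \<Otimes>\<^sub>M draw)"
      unfolding G_def case_prod_beta' by measurable
    show "(\<integral>d. G (s, d) \<partial>draw) = 0" for s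
      using integral_draw_law_quantization[OF M Q, where x="\<lambda>m. Fm m (zhalf k s) - Fm m (w k s)" and v="V s" and \<tau>=\<tau>]
      by (simp add: G_def F sum_subtractf scaleR_diff_right)
  qed
  then show ?thesis by (simp add: G_def \<Delta>_def q_def)
qed

text \<open>The weight may involve the new iterate: given the past, \<open>z (Suc k)\<close> depends
  only on the index and the quantization randomness, and the coin of the same step is independent of
  both.\<close>

lemma coin_mean_zero:
  assumes k: "k < K" and \<phi>: "(\<lambda>(s, x). \<phi> s x) \<in> borel_measurable (\<F> k \<Otimes>\<^sub>M borel)"
  shows "(\<integral>s. b k s * \<phi> s (z (Suc k) s) \<partial>P) = 0"
proof -
  define g where "g = (\<lambda>s m \<xi>. \<phi> s (prox \<gamma> h (zbar k s
             - \<gamma> *\<^sub>R Q \<xi> (Fm m (zhalf k s) - Fm m (w k s)) - \<gamma> *\<^sub>R F (w k s))))"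
  define G where "G = (\<lambda>(s, d :: nat \<times> 'q \<times> bool). (of_bool (snd (snd d)) - (1 - \<tau>)) * g s (fst d) (fst (snd d)))"
  have s[measurable]: "fst \<in> measurable (\<F> k \<Otimes>\<^sub>M draw) (\<F> k)" by auto
  note [measurable] = joint_oracle_measurable[OF k, unfolded case_prod_beta']
     borelZ_borel[OF prox_measurable]
     measurable_compose[OF s adapted(8)[OF k]] measurable_compose[OF s adapted(3)[OF k]]
     measurable_compose[OF measurable_snd draw_components(3)]
  have "(\<integral>s. G (s, X k s) \<partial>P) = 0"
  proof (rule integral_history_eq_0[OF draws_indep k draws_law[OF k] prob_space_draw])
    have "(\<lambda>e. (\<lambda>(s, x). \<phi> s x) (fst e, prox \<gamma> h (zbar k (fst e)
             - \<gamma> *\<^sub>R Q (fst (snd (snd e))) (Fm (fst (snd e)) (zhalf k (fst e)) - Fm (fst (snd e)) (w k (fst e)))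
             - \<gamma> *\<^sub>R F (w k (fst e))))) \<in> borel_measurable (\<F> k \<Otimes>\<^sub>M draw)"
      by (rule measurable_compose[OF _ \<phi>]) measurable
    then have [measurable]: "(\<lambda>e. g (fst e) (fst (snd e)) (fst (snd (snd e)))) \<in> borel_measurable (\<F> k \<Otimes>\<^sub>M draw)"
      by (simp add: g_def)
    show "G \<in> borel_measurable (\<F> k \<Otimes>\<^sub>M draw)"
      unfolding G_def case_prod_beta' by measurable
    show "(\<integral>d. G (s, d) \<partial>draw) = 0" for s
      using integral_draw_law_coin[OF M prob_space_N, of \<tau> "g s"] \<tau> by (simp add: G_def)
  qed
  also have "(\<integral>s. G (s, X k s) \<partial>P) = (\<integral>s. b k s * \<phi> s (z (Suc k) s) \<partial>P)"
    using z_step[OF k] by (intro Bochner_Integration.integral_cong) (auto simp: G_def b_def g_def)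
  finally show ?thesis .
qed

section \<open>Square integrability of the iterates\<close>

lemma sq_integrable_F:
  assumes y: "sq_integrable P y" "\<And>s. s \<in> space P \<Longrightarrow> y s \<in> Z" "(\<lambda>s. F (y s)) \<in> borel_measurable P"
  shows "sq_integrable P (\<lambda>s. F (y s))"
proof (rule sq_integrable_bound[OF y(3)])
  have "integrable P (\<lambda>s. (norm (y s - z0))\<^sup>2)"
    using sq_integrable_diff[OF y(1) sq_integrable_const] by (simp add: sq_integrable_def)
  then show "integrable P (\<lambda>s. 2 * (L\<^sup>2 * (norm (y s - z0))\<^sup>2 + D\<^sup>2) + 2 * (norm (F z0))\<^sup>2)" by simp
  fix s assume "s \<in> space P"
  then have "(norm (F (y s) - F z0))\<^sup>2 \<le> L\<^sup>2 * (norm (y s - z0))\<^sup>2 + D\<^sup>2"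
    using F_lipschitz y(2) z0 by (auto simp: boundedly_lipschitz_def)
  then show "(norm (F (y s)))\<^sup>2 \<le> 2 * (L\<^sup>2 * (norm (y s - z0))\<^sup>2 + D\<^sup>2) + 2 * (norm (F z0))\<^sup>2"
    using norm_add_sq_le[of "F (y s) - F z0" "F z0"] by simp
qed

lemma sq_integrable_prox:
  assumes y: "sq_integrable P y"
  shows "sq_integrable P (\<lambda>s. prox \<gamma> h (y s))"
proof (rule sq_integrable_bound)
  show "(\<lambda>s. prox \<gamma> h (y s)) \<in> borel_measurable P"
    using y borelZ_borel[OF prox_measurable] by (auto simp: sq_integrable_def)
  show "integrable P (\<lambda>s. 2 * (norm (y s))\<^sup>2 + 2 * (norm (prox \<gamma> h 0))\<^sup>2)"
    using y by (simp add: sq_integrable_def)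
  show "(norm (prox \<gamma> h (y s)))\<^sup>2 \<le> 2 * (norm (y s))\<^sup>2 + 2 * (norm (prox \<gamma> h 0))\<^sup>2" for s
  proof -
    have "(norm (prox \<gamma> h (y s) - prox \<gamma> h 0))\<^sup>2 \<le> (norm (y s))\<^sup>2"
      using prox_nonexpansive[OF h \<gamma>, of "y s" 0] by (intro power_mono) auto
    then show ?thesis using norm_add_sq_le[of "prox \<gamma> h (y s) - prox \<gamma> h 0" "prox \<gamma> h 0"]
      unfolding diff_add_cancel by linarith
  qed
qed

lemma half_step_sq_integrable:
  assumes k: "k < K" and zw: "sq_integrable P (z k)" "sq_integrable P (w k)"
  shows "sq_integrable P (zbar k)" "sq_integrable P (\<lambda>s. F (w k s))" "sq_integrable P (zhalf k)"
    "sq_integrable P (q k)"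
proof -
  have kK: "k \<le> K" using k by simp
  have "sq_integrable P (\<lambda>s. \<tau> *\<^sub>R z k s + (1 - \<tau>) *\<^sub>R w k s)"
    by (intro sq_integrable_add sq_integrable_scaleR zw)
  then show zb: "sq_integrable P (zbar k)" using zbar[OF k] by (simp cong: sq_integrable_cong)
  show Fw: "sq_integrable P (\<lambda>s. F (w k s))"
    using iterates_in_Z k history_P[OF adapted(8)[OF k] kK] by (intro sq_integrable_F zw) auto
  have "sq_integrable P (\<lambda>s. prox \<gamma> h (zbar k s - \<gamma> *\<^sub>R F (w k s)))"
    by (intro sq_integrable_prox sq_integrable_diff sq_integrable_scaleR zb Fw)
  then show "sq_integrable P (zhalf k)" using zhalf[OF k] by (simp cong: sq_integrable_cong)
  then show "sq_integrable P (q k)" using oracle_second_moment(1)[OF k _ zw(2)] by simp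
qed

text \<open>The proximal map, and \<open>F\<close> on \<open>Z\<close>, grow at most linearly, so
  second moments pass from one step to the next; \<open>w (Suc k)\<close> is always one of two
  vectors already treated.\<close>

lemma iterates_sq_integrable: "k \<le> K \<Longrightarrow> sq_integrable P (z k) \<and> sq_integrable P (w k)"
proof (induction k)
  case 0
  show ?case using init sq_integrable_const[of z0] by (simp cong: sq_integrable_cong)
next
  case (Suc k)
  then have k: "k < K" and IH: "sq_integrable P (z k)" "sq_integrable P (w k)" by auto
  note half = half_step_sq_integrable[OF k IH]
  have "sq_integrable P (\<lambda>s. prox \<gamma> h (zbar k s - \<gamma> *\<^sub>R q k s - \<gamma> *\<^sub>R F (w k s)))"
    by (intro sq_integrable_prox sq_integrable_diff sq_integrable_scaleR half)
  then have z: "sq_integrable P (z (Suc k))"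
    using z_step[OF k] by (simp add: q_def cong: sq_integrable_cong)
  moreover have "sq_integrable P (w (Suc k))"
  proof (rule sq_integrable_bound)
    show "w (Suc k) \<in> borel_measurable P"
      using iterates_measurable[OF Suc.prems] history_P[OF borelZ_borel, of _ "Suc k"] k by auto
    show "integrable P (\<lambda>s. (norm (z (Suc k) s))\<^sup>2 + (norm (w k s))\<^sup>2)"
      using z IH by (simp add: sq_integrable_def)
    show "(norm (w (Suc k) s))\<^sup>2 \<le> (norm (z (Suc k) s))\<^sup>2 + (norm (w k s))\<^sup>2" if "s \<in> space P" for s
      using w_step[OF k that] by auto
  qed
  ultimately show ?case by simp
qed

lemma step_sq_integrable:
  assumes k: "k < K"
  shows "sq_integrable P (z k)" "sq_integrable P (w k)" "sq_integrable P (zhalf k)" "sq_integrable P (q k)"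
    "sq_integrable P (z (Suc k))" "sq_integrable P (w (Suc k))" "sq_integrable P (\<Delta> k)"
    "sq_integrable P (\<lambda>s. F (w k s))" "sq_integrable P (\<lambda>s. F (zhalf k s))"
proof -
  show 1: "sq_integrable P (z k)" "sq_integrable P (w k)" "sq_integrable P (z (Suc k))" "sq_integrable P (w (Suc k))"
    using iterates_sq_integrable k by auto
  show 2: "sq_integrable P (zhalf k)" "sq_integrable P (q k)" "sq_integrable P (\<lambda>s. F (w k s))"
    using half_step_sq_integrable[OF k 1(1,2)] by auto
  show 3: "sq_integrable P (\<lambda>s. F (zhalf k s))"
    using zhalf_in_Z k history_P[OF adapted(9)[OF k]] by (intro sq_integrable_F 2) auto
  show "sq_integrable P (\<Delta> k)" unfolding \<Delta>_def[abs_def] by (intro sq_integrable_diff 2 3)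
qed

lemma coin_integrable:
  assumes k: "k < K" and g: "integrable P g"
  shows "integrable P (\<lambda>s. b k s * g s)"
proof (rule Bochner_Integration.integrable_bound[OF g])
  have "b k \<in> borel_measurable P"
    by (rule history_P[OF innovations_measurable(3)[OF lessI]]) (use k in simp_all)
  then show "(\<lambda>s. b k s * g s) \<in> borel_measurable P" using g by measurable
  have "\<bar>b k s\<bar> \<le> 1" for s using \<tau> by (auto simp: b_def)
  then show "AE s in P. norm (b k s * g s) \<le> norm (g s)"
    by (simp add: abs_mult mult_left_le_one_le)
qed

end

section \<open>Step sizes, elementary inequalities and a linear recursion\<close>

lemma step_size_sq:
  fixes \<gamma> L c \<tau> :: real
  assumes "0 < L" "0 < c" "0 < \<gamma>" "\<tau> < 1" and le: "\<gamma> \<le> sqrt (1 - \<tau>) / (2 * L * sqrt c)"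
  shows "4 * c * \<gamma>\<^sup>2 * L\<^sup>2 \<le> 1 - \<tau>"
proof -
  have "\<gamma> * (2 * L * sqrt c) \<le> sqrt (1 - \<tau>)" using assms by (simp add: pos_le_divide_eq)
  then have "(\<gamma> * (2 * L * sqrt c))\<^sup>2 \<le> (sqrt (1 - \<tau>))\<^sup>2" using assms by (intro power_mono) auto
  then show ?thesis using assms by (simp add: power_mult_distrib mult.commute mult.left_commute)
qed

lemma inner_le_weighted_sq:
  fixes x y :: "'a::real_inner"
  assumes "0 < c"
  shows "2 * (x \<bullet> y) \<le> c * (norm x)\<^sup>2 + (norm y)\<^sup>2 / c"
proof -
  have "0 \<le> (norm (c *\<^sub>R x - y))\<^sup>2 / c" using assms by simp
  also have "(norm (c *\<^sub>R x - y))\<^sup>2 = c * (c * (norm x)\<^sup>2 - 2 * (x \<bullet> y) + (norm y)\<^sup>2 / c)"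
    using assms unfolding power2_norm_eq_inner by (simp add: inner_simps inner_commute algebra_simps)
  finally show ?thesis using assms by simp
qed

lemma norm_diff_sq_le:
  fixes x y u :: "'a::real_inner"
  shows "(norm (x - u))\<^sup>2 \<le> 2 * (norm (x - y))\<^sup>2 + 2 * (norm (y - u))\<^sup>2"
  using norm_add_sq_le[of "x - y" "y - u"] by simp

text \<open>Here \<open>A\<close>, \<open>B\<close>, \<open>Y\<close>, \<open>S\<close> are the
  squared distances of \<open>z\<close>, \<open>w\<close>, the half step and the next iterate to the
  solution, while \<open>E\<close>, \<open>G\<close>, \<open>R\<close> are those from the half step
  to \<open>z\<close>, \<open>w\<close> and the next iterate; \<open>c\<close> and \<open>d\<close>
  stand for \<open>\<gamma> * \<mu>F\<close> and \<open>\<gamma> * \<mu>h\<close>. If the potential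
  is large, either the half step is far from the solution, which strong monotonicity penalizes, or
  it is far from \<open>z\<close> or \<open>w\<close>, which the negative squares penalize. Strong
  convexity acts at the next iterate, so its share of \<open>Y\<close> is passed on to
  \<open>R + S\<close>. The part \<open>(1 - \<tau>) / 8 * G\<close> stays available for the oracle
  variance.\<close>

lemma contraction_bound:
  fixes A B Y E G R S c d \<tau> :: real
  assumes c: "0 \<le> c" "0 \<le> d" "c + d \<le> (1 - \<tau>) / 4" and \<tau>: "0 \<le> \<tau>" "\<tau> < 1"
    and nonneg: "0 \<le> Y" "0 \<le> E" "0 \<le> G"
    and le: "A \<le> 2 * E + 2 * Y" "B \<le> 2 * G + 2 * Y" "Y \<le> 2 * R + 2 * S"
  shows "(c + d) / 16 * (\<tau> * A + B) \<le> 2 * c * Y + d * (R + S) + \<tau> * E + (1 - \<tau>) * G - (1 - \<tau>) / 8 * G"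
proof -
  define p where "p = (c + d) / 16"
  have p: "0 \<le> p" "2 * p \<le> (1 - \<tau>) / 32" using c by (auto simp: p_def)
  have "p * (\<tau> * A) \<le> p * (\<tau> * (2 * E + 2 * Y))"
    using p \<tau> le by (intro mult_left_mono) auto
  moreover have "p * B \<le> p * (2 * G + 2 * Y)"
    using p le by (intro mult_left_mono) auto
  moreover have "2 * p * (\<tau> * E) \<le> 1 * (\<tau> * E)" using p \<tau> nonneg by (intro mult_right_mono) auto
  moreover have "2 * p * (\<tau> * Y) \<le> 2 * p * (1 * Y)"
    using p \<tau> nonneg by (intro mult_left_mono mult_right_mono) auto
  moreover have "2 * p * G \<le> (1 - \<tau>) / 32 * G" using p nonneg by (intro mult_right_mono) auto
  moreover have "0 \<le> (1 - \<tau>) * G" using \<tau> nonneg by simp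
  moreover have "4 * p * Y = c * Y / 4 + d * Y / 4" by (simp add: p_def field_simps)
  moreover have "d * Y \<le> d * (2 * R + 2 * S)" using le c by (intro mult_left_mono) auto
  moreover have "0 \<le> c * Y" "0 \<le> d * Y" using c nonneg by auto
  ultimately have "p * (\<tau> * A + B) \<le> 2 * c * Y + d * (R + S) + \<tau> * E + (1 - \<tau>) * G - (1 - \<tau>) / 8 * G"
    by (simp add: algebra_simps diff_divide_distrib)
  then show ?thesis by (simp add: p_def)
qed

text \<open>\<open>e / p\<close> is the fixed point of the recursion and bounds the accumulated
  noise.\<close>

lemma linear_recursion_bound:
  fixes a :: "nat \<Rightarrow> real"
  assumes "\<And>k. k < K \<Longrightarrow> a (Suc k) \<le> (1 - p) * a k + e" "0 < p" "p \<le> 1" "0 \<le> e"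
  shows "k \<le> K \<Longrightarrow> a k \<le> (1 - p) ^ k * a 0 + e / p"
proof (induction k)
  case (Suc k)
  have "a (Suc k) \<le> (1 - p) * a k + e" using assms Suc by simp
  also have "\<dots> \<le> (1 - p) * ((1 - p) ^ k * a 0 + e / p) + e"
    using Suc assms by (intro add_right_mono mult_left_mono) auto
  also have "\<dots> = (1 - p) ^ Suc k * a 0 + e / p" using assms by (simp add: field_simps)
  finally show ?case .
qed (use assms in simp)

lemma vi_solution_finite:
  assumes "proper_fun h" "{x. h x < \<infinity>} \<subseteq> Z" "vi_solution Z F h zs"
  shows "\<bar>h zs\<bar> \<noteq> \<infinity>"
proof
  assume "\<bar>h zs\<bar> = \<infinity>"
  then have inf: "h zs = \<infinity>" using assms(1) by (cases "h zs") (auto simp: proper_fun_def)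
  obtain x r where x: "h x = ereal r" using assms(1) unfolding proper_fun_def by (metis ereal_cases)
  then have "x \<in> Z" using assms(2) by auto
  then have "0 \<le> ereal (F zs \<bullet> (x - zs)) + h x - h zs" using assms(3) unfolding vi_solution_def by blast
  then show False by (simp add: x inf)
qed

section \<open>The potential and the strongly monotone rate\<close>

context quantized_extragradient
begin

text \<open>The weights match the coin. A step bounds \<open>|z' - u|^2\<close> by
  \<open>\<tau> * |z - u|^2 + (1 - \<tau>) * |w - u|^2\<close>, and the mean of
  \<open>|w' - u|^2\<close> over the coin is
  \<open>(1 - \<tau>) * |z' - u|^2 + \<tau> * |w - u|^2\<close>; adding the two leaves the same form
  on both sides.\<close>

definition potential :: "'a \<Rightarrow> nat \<Rightarrow> 'w \<Rightarrow> real" where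
  "potential u k s = \<tau> * (norm (z k s - u))\<^sup>2 + (norm (w k s - u))\<^sup>2"

lemma zhalf_finite: "k < K \<Longrightarrow> s \<in> space P \<Longrightarrow> \<bar>h (zhalf k s)\<bar> \<noteq> \<infinity>"
  unfolding zhalf by (rule prox_finite[OF h \<gamma>])

lemma potential_Suc:
  assumes k: "k < K" and s: "s \<in> space P"
  shows "potential u (Suc k) s = (norm (z (Suc k) s - u))\<^sup>2 + \<tau> * (norm (w k s - u))\<^sup>2
    + b k s * ((norm (z (Suc k) s - u))\<^sup>2 - (norm (w k s - u))\<^sup>2)"
  using w_step[OF k s] by (simp add: potential_def b_def algebra_simps)

lemma potential_step:
  assumes k: "k < K" and s: "s \<in> space P" and mono: "monotone_pair Z F h \<mu>F \<mu>h" and u: "\<bar>h u\<bar> \<noteq> \<infinity>"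
  shows "2 * \<gamma> * (F (zhalf k s) \<bullet> (zhalf k s - u) + real_of_ereal (h (zhalf k s)) - real_of_ereal (h u))
      + potential u (Suc k) s + \<gamma> * \<mu>h * ((norm (zhalf k s - z (Suc k) s))\<^sup>2 + (norm (z (Suc k) s - u))\<^sup>2)
    \<le> potential u k s - (norm (zhalf k s - z (Suc k) s))\<^sup>2
      - \<tau> * (norm (z k s - zhalf k s))\<^sup>2 - (1 - \<tau>) * (norm (w k s - zhalf k s))\<^sup>2
      + 2 * \<gamma> * (q k s \<bullet> (zhalf k s - z (Suc k) s)) + 2 * \<gamma> * (\<Delta> k s \<bullet> (zhalf k s - u))
      + b k s * ((norm (z (Suc k) s - u))\<^sup>2 - (norm (w k s - u))\<^sup>2)"
proof -
  have y: "zhalf k s = prox \<gamma> h (\<tau> *\<^sub>R z k s + (1 - \<tau>) *\<^sub>R w k s - \<gamma> *\<^sub>R F (w k s))"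
    using zhalf[OF k s] zbar[OF k s] by simp
  have p: "z (Suc k) s = prox \<gamma> h (\<tau> *\<^sub>R z k s + (1 - \<tau>) *\<^sub>R w k s - \<gamma> *\<^sub>R q k s - \<gamma> *\<^sub>R F (w k s))"
    using z_step[OF k s] zbar[OF k s] by (simp add: q_def)
  have "F (w k s) + q k s = F (zhalf k s) - \<Delta> k s" by (simp add: \<Delta>_def)
  then have e: "(F (w k s) + q k s) \<bullet> (zhalf k s - u) = F (zhalf k s) \<bullet> (zhalf k s - u) - \<Delta> k s \<bullet> (zhalf k s - u)"
    by (simp add: inner_diff_left)
  have split: "2 * \<gamma> * (a - d + c - c') = 2 * \<gamma> * (a + c - c') - 2 * \<gamma> * d" for a d c c' :: real
    by (simp add: algebra_simps)
  have "(1 - \<tau>) * (norm (w k s - u))\<^sup>2 = (norm (w k s - u))\<^sup>2 - \<tau> * (norm (w k s - u))\<^sup>2"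
    by (simp add: left_diff_distrib)
  with extragradient_step[OF h \<gamma> mono Z(2) u y p, unfolded e split]
  show ?thesis unfolding potential_Suc[OF k s] unfolding potential_def by linarith
qed

lemma potential_integrable: "k \<le> K \<Longrightarrow> integrable P (potential u k)"
  using iterates_sq_integrable[of k] sq_integrable_diff[OF _ sq_integrable_const[of u]]
  unfolding potential_def[abs_def] by (auto simp: sq_integrable_def)

text \<open>The variational inequality at the half step together with strong monotonicity of
  \<open>F\<close> bounds the operator bracket of \<open>potential_step\<close> below by
  \<open>\<mu>F * |y - zs|^2\<close>; \<open>contraction_bound\<close> turns this and the remaining
  squares into a decrease of the potential.\<close>

lemma strongly_monotone_step:
  assumes k: "k < K" and s: "s \<in> space P" and mono: "monotone_pair Z F h \<mu>F \<mu>h"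
    and \<mu>: "0 \<le> \<mu>F" "0 \<le> \<mu>h" "\<gamma> * (\<mu>F + \<mu>h) \<le> (1 - \<tau>) / 4" and zs: "vi_solution Z F h zs"
  shows "potential zs (Suc k) s \<le> (1 - \<gamma> * ((\<mu>F + \<mu>h) / 16)) * potential zs k s
     + \<gamma>\<^sup>2 * (norm (q k s))\<^sup>2 - (1 - \<tau>) / 8 * (norm (zhalf k s - w k s))\<^sup>2
     + 2 * \<gamma> * (\<Delta> k s \<bullet> (zhalf k s - zs))
     + b k s * ((norm (z (Suc k) s - zs))\<^sup>2 - (norm (w k s - zs))\<^sup>2)"
proof -
  let ?y = "zhalf k s"
  have fin: "\<bar>h zs\<bar> \<noteq> \<infinity>" by (rule vi_solution_finite[OF h(1) Z(2) zs])
  have yZ: "?y \<in> Z" by (rule zhalf_in_Z[OF s k])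
  then have "0 \<le> ereal (F zs \<bullet> (?y - zs)) + h ?y - h zs" "zs \<in> Z"
    using zs by (auto simp: vi_solution_def)
  then have "0 \<le> F zs \<bullet> (?y - zs) + real_of_ereal (h ?y) - real_of_ereal (h zs)"
    using fin zhalf_finite[OF k s] by (cases "h ?y"; cases "h zs") auto
  moreover have "\<mu>F * (norm (?y - zs))\<^sup>2 \<le> (F ?y - F zs) \<bullet> (?y - zs)"
    using mono yZ \<open>zs \<in> Z\<close> by (auto simp: monotone_pair_def)
  ultimately have "\<mu>F * (norm (?y - zs))\<^sup>2 \<le> F ?y \<bullet> (?y - zs) + real_of_ereal (h ?y) - real_of_ereal (h zs)"
    by (simp add: inner_diff_left)
  then have 1: "2 * \<gamma> * (\<mu>F * (norm (?y - zs))\<^sup>2)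
      \<le> 2 * \<gamma> * (F ?y \<bullet> (?y - zs) + real_of_ereal (h ?y) - real_of_ereal (h zs))"
    using \<gamma> by (intro mult_left_mono) auto
  \<comment> \<open>Weight 1 in Young's inequality uses up the negative \<open>|y - z'|^2\<close>;
    the multiple of the same square coming from strong convexity is kept for fact 3.\<close>
  have 2: "2 * \<gamma> * (q k s \<bullet> (?y - z (Suc k) s)) \<le> \<gamma>\<^sup>2 * (norm (q k s))\<^sup>2 + (norm (?y - z (Suc k) s))\<^sup>2"
    using inner_le_weighted_sq[of 1 "\<gamma> *\<^sub>R q k s" "?y - z (Suc k) s"] by (simp add: power_mult_distrib)
  have 3: "(\<gamma> * \<mu>F + \<gamma> * \<mu>h) / 16 * (\<tau> * (norm (z k s - zs))\<^sup>2 + (norm (w k s - zs))\<^sup>2)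
    \<le> 2 * (\<gamma> * \<mu>F) * (norm (?y - zs))\<^sup>2 + \<gamma> * \<mu>h * ((norm (?y - z (Suc k) s))\<^sup>2 + (norm (z (Suc k) s - zs))\<^sup>2)
      + \<tau> * (norm (z k s - ?y))\<^sup>2 + (1 - \<tau>) * (norm (w k s - ?y))\<^sup>2 - (1 - \<tau>) / 8 * (norm (w k s - ?y))\<^sup>2"
    using \<gamma> \<mu> \<tau> by (intro contraction_bound norm_diff_sq_le) (auto simp: distrib_left)
  have 4: "\<gamma> * ((\<mu>F + \<mu>h) / 16) * potential zs k s
      = (\<gamma> * \<mu>F + \<gamma> * \<mu>h) / 16 * (\<tau> * (norm (z k s - zs))\<^sup>2 + (norm (w k s - zs))\<^sup>2)"
    by (simp add: potential_def algebra_simps)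
  have 5: "(1 - \<gamma> * ((\<mu>F + \<mu>h) / 16)) * potential zs k s
      = potential zs k s - \<gamma> * ((\<mu>F + \<mu>h) / 16) * potential zs k s" by (simp add: left_diff_distrib)
  have 6: "2 * \<gamma> * (\<mu>F * (norm (?y - zs))\<^sup>2) = 2 * (\<gamma> * \<mu>F) * (norm (?y - zs))\<^sup>2" by simp
  have 7: "norm (?y - w k s) = norm (w k s - ?y)" by (rule norm_minus_commute)
  show ?thesis unfolding 5 7 using potential_step[OF k s mono fin] 1[unfolded 6] 2 3[folded 4] by linarith
qed

lemma inner_\<Delta>_integrable:
  "k < K \<Longrightarrow> sq_integrable P V \<Longrightarrow> integrable P (\<lambda>s. \<Delta> k s \<bullet> V s)"
  by (rule sq_integrable_inner[OF step_sq_integrable(7)])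

lemma norm_sq_integrable: "sq_integrable P f \<Longrightarrow> integrable P (\<lambda>s. (norm (f s))\<^sup>2)"
  by (simp add: sq_integrable_def)

theorem strongly_monotone_rate:
  assumes mono: "monotone_pair Z F h \<mu>F \<mu>h" and \<mu>: "0 \<le> \<mu>F" "0 \<le> \<mu>h" "0 < \<mu>F + \<mu>h"
    and L: "0 < L" and zs: "vi_solution Z F h zs"
    and \<gamma>1: "\<gamma> \<le> sqrt (1 - \<tau>) / (2 * L * sqrt (2 * \<omega>))" and \<gamma>2: "\<gamma> \<le> (1 - \<tau>) / (4 * (\<mu>F + \<mu>h))"
  shows "expectation (potential zs K)
    \<le> (1 - \<gamma> * ((\<mu>F + \<mu>h) / 16)) ^ (K - 1) * (\<tau> * (norm (z0 - zs))\<^sup>2 + (norm (z0 - zs))\<^sup>2)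
           + 32 * \<gamma> * \<omega> * D\<^sup>2 / (\<mu>F + \<mu>h)"
proof -
  define p where "p = \<gamma> * ((\<mu>F + \<mu>h) / 16)"
  define a where "a = (\<lambda>k. expectation (potential zs k))"
  have \<gamma>\<mu>: "\<gamma> * (\<mu>F + \<mu>h) \<le> (1 - \<tau>) / 4"
    using \<gamma>2 \<mu> by (simp add: pos_le_divide_eq algebra_simps)
  have p: "0 < p" "p \<le> 1" using \<gamma> \<mu> \<gamma>\<mu> \<tau> by (auto simp: p_def)
  \<comment> \<open>\<open>step_size_sq\<close> with \<open>c = 2 * \<omega>\<close>; the factor 1/8
    matches the square left over by \<open>strongly_monotone_step\<close>.\<close>
  have size: "\<gamma>\<^sup>2 * \<omega> * L\<^sup>2 \<le> (1 - \<tau>) / 8"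
    using step_size_sq[OF L _ \<gamma> \<tau>(2) \<gamma>1] \<omega> by (simp add: algebra_simps)
  have rec: "a (Suc k) \<le> (1 - p) * a k + \<gamma>\<^sup>2 * \<omega> * D\<^sup>2" if k: "k < K" for k
  proof -
    note sq = step_sq_integrable[OF k]
    let ?\<phi> = "\<lambda>s x. (norm (x - zs))\<^sup>2 - (norm (w k s - zs))\<^sup>2"
    let ?e = "expectation (\<lambda>s. (norm (zhalf k s - w k s))\<^sup>2)"
    note [measurable] = adapted(6,7)[OF k]
    have V: "sq_integrable P (\<lambda>s. zhalf k s - zs)" by (intro sq_integrable_diff sq sq_integrable_const)
    have int: "integrable P (potential zs k)" "integrable P (potential zs (Suc k))"
      "integrable P (\<lambda>s. (norm (q k s))\<^sup>2)" "integrable P (\<lambda>s. (norm (zhalf k s - w k s))\<^sup>2)"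
      "integrable P (\<lambda>s. \<Delta> k s \<bullet> (zhalf k s - zs))"
      "integrable P (\<lambda>s. b k s * ?\<phi> s (z (Suc k) s))"
      using k by (intro potential_integrable coin_integrable Bochner_Integration.integrable_diff
        inner_\<Delta>_integrable norm_sq_integrable sq_integrable_diff sq sq_integrable_const; simp)+
    have "a (Suc k) \<le> expectation (\<lambda>s. (1 - p) * potential zs k s + \<gamma>\<^sup>2 * (norm (q k s))\<^sup>2
        - (1 - \<tau>) / 8 * (norm (zhalf k s - w k s))\<^sup>2 + 2 * \<gamma> * (\<Delta> k s \<bullet> (zhalf k s - zs))
        + b k s * ?\<phi> s (z (Suc k) s))"
      unfolding a_def p_def
    proof (rule integral_mono)
      fix s assume s: "s \<in> space P"
      show "potential zs (Suc k) s \<le> (1 - \<gamma> * ((\<mu>F + \<mu>h) / 16)) * potential zs k s + \<gamma>\<^sup>2 * (norm (q k s))\<^sup>2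
        - (1 - \<tau>) / 8 * (norm (zhalf k s - w k s))\<^sup>2 + 2 * \<gamma> * (\<Delta> k s \<bullet> (zhalf k s - zs))
        + b k s * ?\<phi> s (z (Suc k) s)"
        by (rule strongly_monotone_step[OF k s mono \<mu>(1,2) \<gamma>\<mu> zs])
    qed (use int in auto)
    also have "\<dots> = (1 - p) * a k + \<gamma>\<^sup>2 * expectation (\<lambda>s. (norm (q k s))\<^sup>2) - (1 - \<tau>) / 8 * ?e
        + 2 * \<gamma> * expectation (\<lambda>s. \<Delta> k s \<bullet> (zhalf k s - zs))
        + expectation (\<lambda>s. b k s * ?\<phi> s (z (Suc k) s))"
      unfolding a_def using int by simp
    also have "expectation (\<lambda>s. \<Delta> k s \<bullet> (zhalf k s - zs)) = 0"
      by (rule \<Delta>_mean_zero[OF k]) measurable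
    also have "expectation (\<lambda>s. b k s * ?\<phi> s (z (Suc k) s)) = 0"
      by (rule coin_mean_zero[OF k]) measurable
    finally have 1: "a (Suc k) \<le> (1 - p) * a k + \<gamma>\<^sup>2 * expectation (\<lambda>s. (norm (q k s))\<^sup>2) - (1 - \<tau>) / 8 * ?e"
      by simp
    have "\<gamma>\<^sup>2 * expectation (\<lambda>s. (norm (q k s))\<^sup>2) \<le> \<gamma>\<^sup>2 * (\<omega> * (L\<^sup>2 * ?e + D\<^sup>2))"
      by (intro mult_left_mono oracle_second_moment(2)[OF k sq(3,2)]) simp
    moreover have "\<gamma>\<^sup>2 * \<omega> * L\<^sup>2 * ?e \<le> (1 - \<tau>) / 8 * ?e"
      using size by (intro mult_right_mono) auto
    moreover have "\<gamma>\<^sup>2 * (\<omega> * (L\<^sup>2 * ?e + D\<^sup>2)) = \<gamma>\<^sup>2 * \<omega> * L\<^sup>2 * ?e + \<gamma>\<^sup>2 * \<omega> * D\<^sup>2"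
      by (simp add: algebra_simps)
    ultimately show ?thesis using 1 by linarith
  qed
  \<comment> \<open>The recursion gives the exponent \<open>K\<close> and the noise level
    \<open>16 * \<gamma> * \<omega> * D^2 / (\<mu>F + \<mu>h)\<close>; the stated exponent
    \<open>K - 1\<close> and constant 32 are weaker, since \<open>1 - p\<close> lies between 0 and
    1.\<close>
  have "a K \<le> (1 - p) ^ K * a 0 + \<gamma>\<^sup>2 * \<omega> * D\<^sup>2 / p"
    using p \<omega> by (intro linear_recursion_bound[where K=K] rec) auto
  moreover have a0: "a 0 = \<tau> * (norm (z0 - zs))\<^sup>2 + (norm (z0 - zs))\<^sup>2"
  proof -
    have "a 0 = expectation (\<lambda>s. \<tau> * (norm (z0 - zs))\<^sup>2 + (norm (z0 - zs))\<^sup>2)"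
      unfolding a_def by (rule Bochner_Integration.integral_cong) (simp_all add: potential_def init)
    then show ?thesis by (simp add: prob_space)
  qed
  moreover have "(1 - p) ^ K * a 0 \<le> (1 - p) ^ (K - 1) * (\<tau> * (norm (z0 - zs))\<^sup>2 + (norm (z0 - zs))\<^sup>2)"
    unfolding a0[symmetric] using p \<tau> by (intro mult_right_mono power_decreasing) (auto simp: a0)
  moreover have "\<gamma>\<^sup>2 * \<omega> * D\<^sup>2 / p \<le> 32 * \<gamma> * \<omega> * D\<^sup>2 / (\<mu>F + \<mu>h)"
  proof -
    have "\<gamma>\<^sup>2 * \<omega> * D\<^sup>2 / p = 16 * (\<gamma> * \<omega> * D\<^sup>2 / (\<mu>F + \<mu>h))"
      using \<gamma> by (simp add: p_def power2_eq_square)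
    moreover have "0 \<le> \<gamma> * \<omega> * D\<^sup>2 / (\<mu>F + \<mu>h)" using \<gamma> \<omega> \<mu> by (intro divide_nonneg_pos) auto
    ultimately show ?thesis by simp
  qed
  ultimately show ?thesis unfolding a_def p_def by linarith
qed

section \<open>Martingale part and gap bound in the monotone case\<close>

definition noise :: "nat \<Rightarrow> 'w \<Rightarrow> 'a" where
  "noise k s = - (2 * \<gamma>) *\<^sub>R \<Delta> k s - (2 * b k s) *\<^sub>R (z (Suc k) s - w k s)"

text \<open>The part of the one-step bound that is free of \<open>u\<close> once \<open>u\<close> is
  written as \<open>z0 + (u - z0)\<close> in the centred terms; \<open>noise\<close> is the slope in
  \<open>u - z0\<close>.\<close>

definition drift :: "nat \<Rightarrow> 'w \<Rightarrow> real" where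
  "drift k s = 2 * \<gamma>\<^sup>2 * (norm (q k s))\<^sup>2 - (norm (zhalf k s - z (Suc k) s))\<^sup>2 / 2
     - (1 - \<tau>) * (norm (w k s - zhalf k s))\<^sup>2 + 2 * \<gamma> * (\<Delta> k s \<bullet> (zhalf k s - z0))
     + b k s * ((norm (z (Suc k) s - w k s))\<^sup>2 + 2 * ((z (Suc k) s - w k s) \<bullet> (w k s - z0)))"

definition noise_sum :: "nat \<Rightarrow> 'w \<Rightarrow> 'a" where
  "noise_sum k s = (\<Sum>j<k. noise j s)"

definition gap_bound :: "nat \<Rightarrow> 'w \<Rightarrow> real" where
  "gap_bound k s = (\<Sum>j<k. drift j s) + (norm (noise_sum k s))\<^sup>2 / 56"

lemma monotone_step:
  assumes k: "k < K" and s: "s \<in> space P" and mono: "monotone_pair Z F h 0 0"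
    and u: "\<bar>h u\<bar> \<noteq> \<infinity>" "u \<in> Z"
  shows "2 * \<gamma> * (F u \<bullet> (zhalf k s - u) + real_of_ereal (h (zhalf k s)) - real_of_ereal (h u))
    \<le> potential u k s - potential u (Suc k) s + drift k s + noise k s \<bullet> (u - z0)"
proof -
  let ?y = "zhalf k s" and ?a = "z (Suc k) s - w k s"
  have "0 \<le> (F ?y - F u) \<bullet> (?y - u)"
    using mono zhalf_in_Z[OF s k] u by (auto simp: monotone_pair_def)
  then have "F u \<bullet> (?y - u) + real_of_ereal (h ?y) - real_of_ereal (h u)
      \<le> F ?y \<bullet> (?y - u) + real_of_ereal (h ?y) - real_of_ereal (h u)"
    by (simp add: inner_diff_left)
  then have 1: "2 * \<gamma> * (F u \<bullet> (?y - u) + real_of_ereal (h ?y) - real_of_ereal (h u))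
      \<le> 2 * \<gamma> * (F ?y \<bullet> (?y - u) + real_of_ereal (h ?y) - real_of_ereal (h u))"
    using \<gamma> by (intro mult_left_mono) auto
  \<comment> \<open>Weight 2 instead of 1 keeps half of the negative \<open>|y - z'|^2\<close>,
    which later pays for the growth of the squared noise sum.\<close>
  have 2: "2 * \<gamma> * (q k s \<bullet> (?y - z (Suc k) s)) \<le> 2 * \<gamma>\<^sup>2 * (norm (q k s))\<^sup>2 + (norm (?y - z (Suc k) s))\<^sup>2 / 2"
    using inner_le_weighted_sq[of 2 "\<gamma> *\<^sub>R q k s" "?y - z (Suc k) s"] by (simp add: power_mult_distrib)
  have "(norm (z (Suc k) s - u))\<^sup>2 - (norm (w k s - u))\<^sup>2
      = (norm ?a)\<^sup>2 + 2 * (?a \<bullet> (w k s - z0)) - 2 * (?a \<bullet> (u - z0))"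
    unfolding power2_norm_eq_inner by (simp add: inner_simps inner_commute)
  then have 3: "b k s * ((norm (z (Suc k) s - u))\<^sup>2 - (norm (w k s - u))\<^sup>2)
      = b k s * ((norm ?a)\<^sup>2 + 2 * (?a \<bullet> (w k s - z0))) - 2 * (b k s * (?a \<bullet> (u - z0)))"
    by (simp only: right_diff_distrib mult.left_commute)
  have "\<Delta> k s \<bullet> (?y - u) = \<Delta> k s \<bullet> (?y - z0) - \<Delta> k s \<bullet> (u - z0)"
    by (simp add: inner_diff_right)
  then have 4: "2 * \<gamma> * (\<Delta> k s \<bullet> (?y - u)) = 2 * \<gamma> * (\<Delta> k s \<bullet> (?y - z0)) - 2 * \<gamma> * (\<Delta> k s \<bullet> (u - z0))"
    by (simp add: right_diff_distrib)
  have 5: "noise k s \<bullet> (u - z0) = - (2 * \<gamma> * (\<Delta> k s \<bullet> (u - z0))) - 2 * (b k s * (?a \<bullet> (u - z0)))"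
    by (simp only: noise_def inner_diff_left inner_scaleR_left)
  have 6: "0 \<le> \<tau> * (norm (z k s - ?y))\<^sup>2" using \<tau> by simp
  show ?thesis
    using potential_step[OF k s mono u(1)] 1 2 5 6 unfolding drift_def 3 4 by simp
qed

lemma noise_adapted: "k < l \<Longrightarrow> l \<le> K \<Longrightarrow> noise k \<in> borel_measurable (\<F> l)"
proof -
  assume k: "k < l" "l \<le> K"
  then have kK: "k < K" by simp
  note [measurable] = innovations_measurable(2,3)[OF k]
    history_mono[OF adapted(6)[OF kK] less_imp_le[OF k(1)] k(2)]
  have "z (Suc k) \<in> borel_measurable (\<F> (Suc k))"
    by (rule borelZ_borel[OF iterates_measurable[THEN conjunct1]]) (use kK in simp)
  then have [measurable]: "z (Suc k) \<in> borel_measurable (\<F> l)"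
    by (rule history_mono) (use k in simp_all)
  show ?thesis unfolding noise_def[abs_def] by measurable
qed

lemma noise_sum_adapted: "k \<le> K \<Longrightarrow> noise_sum k \<in> borel_measurable (\<F> k)"
  unfolding noise_sum_def[abs_def] by (rule borel_measurable_sum) (simp add: noise_adapted)

lemma noise_sq_integrable:
  assumes k: "k < K"
  shows "sq_integrable P (noise k)"
proof -
  note sq = step_sq_integrable[OF k]
  have [measurable]: "b k \<in> borel_measurable P"
    by (rule history_P[OF innovations_measurable(3)[OF lessI]]) (use k in simp_all)
  have a: "sq_integrable P (\<lambda>s. z (Suc k) s - w k s)" by (intro sq_integrable_diff sq)
  then have [measurable]: "(\<lambda>s. z (Suc k) s - w k s) \<in> borel_measurable P" by (simp add: sq_integrable_def)
  have "sq_integrable P (\<lambda>s. b k s *\<^sub>R (z (Suc k) s - w k s))"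
  proof (rule sq_integrable_bound)
    show "integrable P (\<lambda>s. (norm (z (Suc k) s - w k s))\<^sup>2)" by (rule norm_sq_integrable[OF a])
    have "(b k s)\<^sup>2 \<le> 1" for s using \<tau> by (auto simp: b_def abs_square_le_1)
    then show "(norm (b k s *\<^sub>R (z (Suc k) s - w k s)))\<^sup>2 \<le> (norm (z (Suc k) s - w k s))\<^sup>2" for s
      by (simp add: power_mult_distrib mult_left_le_one_le)
  qed measurable
  from sq_integrable_diff[OF sq_integrable_scaleR[OF sq(7), of "- (2 * \<gamma>)"] sq_integrable_scaleR[OF this, of 2]]
  show ?thesis unfolding noise_def[abs_def] by simp
qed

lemma noise_sum_sq_integrable: "k \<le> K \<Longrightarrow> sq_integrable P (noise_sum k)"
proof (induction k)
  case 0
  show ?case using sq_integrable_const[of 0] by (simp add: noise_sum_def[abs_def])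
next
  case (Suc k)
  then show ?case using sq_integrable_add[of P "noise_sum k" "noise k"] noise_sq_integrable[of k]
    by (simp add: noise_sum_def[abs_def])
qed

text \<open>\<open>\<Delta>_weight\<close> and \<open>coin_weight\<close> are the coefficients of
  \<open>\<Delta>\<close> and \<open>b\<close> after the increment of \<open>gap_bound\<close> is
  expanded. The former is known before draw \<open>k\<close>; the latter may also use the new
  iterate, as \<open>coin_mean_zero\<close> permits.\<close>

definition \<Delta>_weight :: "nat \<Rightarrow> 'w \<Rightarrow> 'a" where
  "\<Delta>_weight k s = (2 * \<gamma>) *\<^sub>R (zhalf k s - z0) + (2 * \<gamma>\<^sup>2 / 7) *\<^sub>R (F (zhalf k s) - F (w k s))
     - (\<gamma> / 14) *\<^sub>R noise_sum k s"

definition coin_weight :: "nat \<Rightarrow> 'w \<Rightarrow> 'a \<Rightarrow> real" where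
  "coin_weight k s x = (norm (x - w k s))\<^sup>2 + 2 * ((x - w k s) \<bullet> (w k s - z0))
     - (noise_sum k s \<bullet> (x - w k s)) / 14 + (2 * \<tau> - 1) / 7 * (norm (x - w k s))\<^sup>2"

text \<open>The variance computation is done pointwise: squares of \<open>\<Delta>\<close> and
  \<open>b\<close> are replaced by noncentred bounds plus multiples of \<open>\<Delta>\<close> and
  \<open>b\<close> themselves, and these multiples join the weights. In expectation only the
  explicit quadratic terms survive.\<close>

lemma gap_bound_step:
  assumes k: "k < K" and s: "s \<in> space P"
  shows "gap_bound (Suc k) s \<le> gap_bound k s + 3 * \<gamma>\<^sup>2 * (norm (q k s))\<^sup>2
    - (1 - \<tau>) / 2 * (norm (zhalf k s - w k s))\<^sup>2 + \<Delta> k s \<bullet> \<Delta>_weight k s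
    + b k s * coin_weight k s (z (Suc k) s)"
proof -
  define y a S d where "y = zhalf k s" and "a = z (Suc k) s - w k s" and "S = noise_sum k s"
    and "d = F y - F (w k s)"
  have n: "noise k s = - 2 *\<^sub>R (\<gamma> *\<^sub>R \<Delta> k s + b k s *\<^sub>R a)"
    by (simp add: noise_def a_def scaleR_right_distrib)
  have "(norm (noise k s))\<^sup>2 = 4 * (norm (\<gamma> *\<^sub>R \<Delta> k s + b k s *\<^sub>R a))\<^sup>2"
    unfolding n by (simp add: power_mult_distrib)
  then have 1: "(norm (noise k s))\<^sup>2 \<le> 8 * (\<gamma>\<^sup>2 * (norm (\<Delta> k s))\<^sup>2) + 8 * ((b k s)\<^sup>2 * (norm a)\<^sup>2)"
    using norm_add_sq_le[of "\<gamma> *\<^sub>R \<Delta> k s" "b k s *\<^sub>R a"] by (simp add: power_mult_distrib)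
  have "q k s = d - \<Delta> k s" by (simp add: \<Delta>_def d_def y_def)
  then have "(norm (q k s))\<^sup>2 = (norm d)\<^sup>2 - 2 * (\<Delta> k s \<bullet> d) + (norm (\<Delta> k s))\<^sup>2"
    unfolding power2_norm_eq_inner by (simp add: inner_simps inner_commute)
  \<comment> \<open>Variance at most second moment, before taking expectations: \<open>|d|^2\<close>
    is dropped, and the cross term with \<open>d\<close> is centred since \<open>d\<close> is known
    before the draw.\<close>
  then have "(norm (\<Delta> k s))\<^sup>2 \<le> (norm (q k s))\<^sup>2 + 2 * (\<Delta> k s \<bullet> d)" by simp
  then have 2: "\<gamma>\<^sup>2 * (norm (\<Delta> k s))\<^sup>2 \<le> \<gamma>\<^sup>2 * (norm (q k s))\<^sup>2 + 2 * (\<gamma>\<^sup>2 * (\<Delta> k s \<bullet> d))"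
    using mult_left_mono[of _ _ "\<gamma>\<^sup>2"] by (fastforce simp: distrib_left)
  \<comment> \<open>The variance of the coin plus a multiple of the centred coin, because an
    indicator equals its square.\<close>
  have "(b k s)\<^sup>2 = \<tau> * (1 - \<tau>) + (2 * \<tau> - 1) * b k s"
    by (simp add: b_def power2_eq_square algebra_simps)
  then have 3: "(b k s)\<^sup>2 * (norm a)\<^sup>2 = \<tau> * (1 - \<tau>) * (norm a)\<^sup>2 + (2 * \<tau> - 1) * (b k s * (norm a)\<^sup>2)"
    by (simp only: distrib_right mult.assoc)
  define R G where "R = (norm (y - z (Suc k) s))\<^sup>2" and "G = (norm (y - w k s))\<^sup>2"
  have RG: "0 \<le> R" "0 \<le> G" by (auto simp: R_def G_def)
  have "(norm a)\<^sup>2 \<le> 2 * R + 2 * G"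
    using norm_diff_sq_le[of "z (Suc k) s" "w k s" y] by (simp add: a_def R_def G_def norm_minus_commute)
  then have "\<tau> * (1 - \<tau>) * (norm a)\<^sup>2 \<le> \<tau> * (1 - \<tau>) * (2 * R + 2 * G)"
    using \<tau> by (intro mult_left_mono) auto
  moreover have "\<tau> * (1 - \<tau>) * R \<le> 1 * R" using \<tau> RG by (intro mult_right_mono mult_le_one) auto
  moreover have "\<tau> * (1 - \<tau>) * G \<le> (1 - \<tau>) * G"
    using \<tau> RG by (intro mult_right_mono mult_left_le_one_le) auto
  ultimately have 4: "\<tau> * (1 - \<tau>) * (norm a)\<^sup>2 \<le> 2 * R + 2 * ((1 - \<tau>) * G)"
    by (simp add: algebra_simps)
  have 5: "S \<bullet> noise k s = - 2 * (\<gamma> * (\<Delta> k s \<bullet> S)) - 2 * (b k s * (S \<bullet> a))"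
    unfolding n by (simp add: inner_add_right inner_commute)
  have 6: "(norm (noise_sum (Suc k) s))\<^sup>2 = (norm S)\<^sup>2 + 2 * (S \<bullet> noise k s) + (norm (noise k s))\<^sup>2"
    unfolding power2_norm_eq_inner noise_sum_def S_def by (simp add: inner_simps inner_commute)
  have 7: "\<Delta> k s \<bullet> \<Delta>_weight k s = 2 * \<gamma> * (\<Delta> k s \<bullet> (y - z0)) + 2 / 7 * (\<gamma>\<^sup>2 * (\<Delta> k s \<bullet> d)) - (\<gamma> * (\<Delta> k s \<bullet> S)) / 14"
    unfolding \<Delta>_weight_def y_def[symmetric] d_def[symmetric] S_def[symmetric]
    by (simp only: inner_diff_right[of "\<Delta> k s" "_ + _"] inner_add_right inner_scaleR_right)
  have 8: "b k s * coin_weight k s (z (Suc k) s) = b k s * ((norm a)\<^sup>2 + 2 * (a \<bullet> (w k s - z0)))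
      - (b k s * (S \<bullet> a)) / 14 + (2 * \<tau> - 1) * (b k s * (norm a)\<^sup>2) / 7"
    unfolding coin_weight_def a_def[symmetric] S_def[symmetric] by (simp add: algebra_simps)
  have 9: "gap_bound (Suc k) s = gap_bound k s + drift k s + (S \<bullet> noise k s) / 28 + (norm (noise k s))\<^sup>2 / 56"
    unfolding gap_bound_def 6 by (simp add: S_def)
  have 10: "drift k s = 2 * (\<gamma>\<^sup>2 * (norm (q k s))\<^sup>2) - R / 2 - (1 - \<tau>) * G + 2 * \<gamma> * (\<Delta> k s \<bullet> (y - z0))
     + b k s * ((norm a)\<^sup>2 + 2 * (a \<bullet> (w k s - z0)))"
    by (simp add: drift_def R_def G_def y_def a_def norm_minus_commute)
  have 11: "0 \<le> (1 - \<tau>) * G" "0 \<le> \<gamma>\<^sup>2 * (norm (q k s))\<^sup>2" using \<tau> RG by auto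
  \<comment> \<open>The bounds of fact 1 enter with factor 8/56 = 1/7. This raises
    \<open>2 * \<gamma>^2 * |q|^2\<close> to at most \<open>3 * \<gamma>^2 * |q|^2\<close>, takes
    2/7 of \<open>R\<close> where \<open>R / 2\<close> is available, and 2/7 of
    \<open>(1 - \<tau>) * G\<close>, so that at least half of the latter remains.\<close>
  have "gap_bound (Suc k) s \<le> gap_bound k s + 3 * (\<gamma>\<^sup>2 * (norm (q k s))\<^sup>2)
    - ((1 - \<tau>) * G) / 2 + \<Delta> k s \<bullet> \<Delta>_weight k s + b k s * coin_weight k s (z (Suc k) s)"
    unfolding 9 10 7 8 5 using 1 2 3 4 11 RG by argo
  then show ?thesis by (simp add: G_def y_def)
qed

lemma gap_bound_expectation:
  assumes L: "0 < L" and \<gamma>1: "\<gamma> \<le> sqrt (1 - \<tau>) / (2 * L * sqrt (4 * \<omega> + 2))"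
  shows "k \<le> K \<Longrightarrow> integrable P (gap_bound k) \<and> expectation (gap_bound k) \<le> real k * (3 * \<gamma>\<^sup>2 * \<omega> * D\<^sup>2)"
proof (induction k)
  case 0
  then show ?case by (simp add: gap_bound_def[abs_def] noise_sum_def)
next
  case (Suc k)
  then have k: "k < K" and IH: "integrable P (gap_bound k)"
      "expectation (gap_bound k) \<le> real k * (3 * \<gamma>\<^sup>2 * \<omega> * D\<^sup>2)" by auto
  note sq = step_sq_integrable[OF k]
  let ?e = "expectation (\<lambda>s. (norm (zhalf k s - w k s))\<^sup>2)"
  have kK: "k \<le> K" using k by simp
  note [measurable] = adapted(6,7,8,9)[OF k] noise_sum_adapted[OF kK]
  have V: "sq_integrable P (\<Delta>_weight k)" unfolding \<Delta>_weight_def[abs_def]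
    by (intro sq_integrable_diff sq_integrable_add sq_integrable_scaleR sq sq_integrable_const
        noise_sum_sq_integrable kK)
  have a: "sq_integrable P (\<lambda>s. z (Suc k) s - w k s)" by (intro sq_integrable_diff sq)
  have wz: "sq_integrable P (\<lambda>s. w k s - z0)" by (intro sq_integrable_diff sq sq_integrable_const)
  have "integrable P (\<lambda>s. coin_weight k s (z (Suc k) s))"
    unfolding coin_weight_def
    using norm_sq_integrable[OF a] sq_integrable_inner[OF a wz]
      sq_integrable_inner[OF noise_sum_sq_integrable[OF kK] a]
    by simp
  note cw = coin_integrable[OF k this]
  have int: "integrable P (\<lambda>s. (norm (q k s))\<^sup>2)" "integrable P (\<lambda>s. (norm (zhalf k s - w k s))\<^sup>2)"
      "integrable P (\<lambda>s. \<Delta> k s \<bullet> \<Delta>_weight k s)"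
    by (intro inner_\<Delta>_integrable k V norm_sq_integrable sq_integrable_diff sq)+
  have drift: "integrable P (drift k)"
  proof -
    have "integrable P (\<lambda>s. (norm (zhalf k s - z (Suc k) s))\<^sup>2)" "integrable P (\<lambda>s. (norm (w k s - zhalf k s))\<^sup>2)"
      "integrable P (\<lambda>s. \<Delta> k s \<bullet> (zhalf k s - z0))"
      by (intro inner_\<Delta>_integrable k norm_sq_integrable sq_integrable_diff sq sq_integrable_const)+
    moreover have "integrable P (\<lambda>s. b k s * ((norm (z (Suc k) s - w k s))\<^sup>2 + 2 * ((z (Suc k) s - w k s) \<bullet> (w k s - z0))))"
      using norm_sq_integrable[OF a] sq_integrable_inner[OF a wz] by (intro coin_integrable[OF k]) simp
    ultimately show ?thesis unfolding drift_def[abs_def] using int by simp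
  qed
  have gi: "integrable P (gap_bound (Suc k))"
  proof -
    have "integrable P (\<lambda>s. gap_bound k s - (norm (noise_sum k s))\<^sup>2 / 56 + drift k s + (norm (noise_sum (Suc k) s))\<^sup>2 / 56)"
      using IH(1) drift norm_sq_integrable[OF noise_sum_sq_integrable[OF kK]]
        norm_sq_integrable[OF noise_sum_sq_integrable[OF Suc.prems]] by simp
    then show ?thesis by (simp add: gap_bound_def[abs_def])
  qed
  have "expectation (gap_bound (Suc k)) \<le> expectation (\<lambda>s. gap_bound k s + 3 * \<gamma>\<^sup>2 * (norm (q k s))\<^sup>2
    - (1 - \<tau>) / 2 * (norm (zhalf k s - w k s))\<^sup>2 + \<Delta> k s \<bullet> \<Delta>_weight k s
    + b k s * coin_weight k s (z (Suc k) s))"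
    by (rule integral_mono[OF gi _ gap_bound_step[OF k]]) (use int IH cw in auto)
  also have "\<dots> = expectation (gap_bound k) + 3 * \<gamma>\<^sup>2 * expectation (\<lambda>s. (norm (q k s))\<^sup>2) - (1 - \<tau>) / 2 * ?e
      + expectation (\<lambda>s. \<Delta> k s \<bullet> \<Delta>_weight k s) + expectation (\<lambda>s. b k s * coin_weight k s (z (Suc k) s))"
    using int IH cw by simp
  also have "expectation (\<lambda>s. \<Delta> k s \<bullet> \<Delta>_weight k s) = 0"
    by (rule \<Delta>_mean_zero[OF k]) (unfold \<Delta>_weight_def[abs_def], measurable)
  also have "expectation (\<lambda>s. b k s * coin_weight k s (z (Suc k) s)) = 0"
    by (rule coin_mean_zero[OF k]) (unfold coin_weight_def, measurable)
  finally have 1: "expectation (gap_bound (Suc k))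
      \<le> expectation (gap_bound k) + 3 * \<gamma>\<^sup>2 * expectation (\<lambda>s. (norm (q k s))\<^sup>2) - (1 - \<tau>) / 2 * ?e"
    by simp
  have "3 * \<gamma>\<^sup>2 * expectation (\<lambda>s. (norm (q k s))\<^sup>2) \<le> 3 * \<gamma>\<^sup>2 * (\<omega> * (L\<^sup>2 * ?e + D\<^sup>2))"
    by (intro mult_left_mono oracle_second_moment(2)[OF k sq(3,2)]) simp
  \<comment> \<open>The remaining half of \<open>(1 - \<tau>) * |y - w|^2\<close> absorbs the
    Lipschitz part of the oracle's second moment, so only the \<open>D\<close> part accumulates over
    the steps.\<close>
  moreover have "3 * \<gamma>\<^sup>2 * \<omega> * L\<^sup>2 * ?e \<le> (1 - \<tau>) / 2 * ?e"
  proof (intro mult_right_mono)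
    have "4 * (4 * \<omega> + 2) * \<gamma>\<^sup>2 * L\<^sup>2 \<le> 1 - \<tau>"
      using \<omega> by (intro step_size_sq[OF L _ \<gamma> \<tau>(2) \<gamma>1]) simp
    moreover define X Y where "X = \<gamma>\<^sup>2 * \<omega> * L\<^sup>2" and "Y = \<gamma>\<^sup>2 * L\<^sup>2"
    ultimately have "16 * X + 8 * Y \<le> 1 - \<tau>" by (simp add: algebra_simps)
    moreover have "0 \<le> X" "0 \<le> Y" using \<omega> by (auto simp: X_def Y_def)
    ultimately have "3 * X \<le> (1 - \<tau>) / 2" by simp
    then show "3 * \<gamma>\<^sup>2 * \<omega> * L\<^sup>2 \<le> (1 - \<tau>) / 2" by (simp only: X_def mult.assoc)
  qed simp
  moreover have "3 * \<gamma>\<^sup>2 * (\<omega> * (L\<^sup>2 * ?e + D\<^sup>2)) = 3 * \<gamma>\<^sup>2 * \<omega> * L\<^sup>2 * ?e + 3 * \<gamma>\<^sup>2 * \<omega> * D\<^sup>2"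
    by (simp add: algebra_simps)
  moreover have "real (Suc k) * (3 * \<gamma>\<^sup>2 * \<omega> * D\<^sup>2) = real k * (3 * \<gamma>\<^sup>2 * \<omega> * D\<^sup>2) + 3 * \<gamma>\<^sup>2 * \<omega> * D\<^sup>2"
    by (simp add: algebra_simps)
  ultimately have "expectation (gap_bound (Suc k)) \<le> real (Suc k) * (3 * \<gamma>\<^sup>2 * \<omega> * D\<^sup>2)"
    using 1 IH(2) by linarith
  with gi show ?case by simp
qed


text \<open>The bound holds for each sample and all \<open>u\<close> in \<open>C\<close> at once, so
  the supremum precedes the expectation. Averaging is exact for the operator term, which is affine
  in the half steps, and costs Jensen's inequality for \<open>h\<close>; points with infinite
  \<open>h u\<close> contribute minus infinity.\<close>

lemma gap_le:
  assumes mono: "monotone_pair Z F h 0 0" and C: "compact C" "C \<subseteq> Z" and K: "K \<ge> 1"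
    and s: "s \<in> space P" and x: "x = (1 / real K) *\<^sub>R (\<Sum>k<K. zhalf k s)"
  shows "gap C F h x \<le> ereal ((16 * (SUP u\<in>C. (norm (z0 - u))\<^sup>2) + gap_bound K s) / (2 * \<gamma> * real K))"
    and "\<bar>h x\<bar> \<noteq> \<infinity>"
proof -
  define r where "r = (1 / real K) * (\<Sum>k<K. real_of_ereal (h (zhalf k s)))"
  define R where "R = (SUP u\<in>C. (norm (z0 - u))\<^sup>2)"
  have Kpos: "0 < real K" using K by simp
  have no_minf: "\<And>y. h y \<noteq> -\<infinity>" using h(1) by (auto simp: proper_fun_def)
  have hx: "h x \<le> ereal r"
    unfolding x r_def using zhalf_finite[OF _ s]
    by (intro convex_fun_average[OF h(3) K _ no_minf]) (simp add: ereal_real)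
  then show fin: "\<bar>h x\<bar> \<noteq> \<infinity>" using no_minf[of x] by (cases "h x") auto
  have "bdd_above ((\<lambda>u. (norm (z0 - u))\<^sup>2) ` C)"
    by (intro bounded_imp_bdd_above compact_imp_bounded compact_continuous_image C continuous_intros)
  then have R: "(norm (z0 - u))\<^sup>2 \<le> R" if "u \<in> C" for u
    unfolding R_def using that by (rule cSUP_upper2) auto
  have "ereal (F u \<bullet> (x - u)) + h x - h u \<le> ereal ((16 * R + gap_bound K s) / (2 * \<gamma> * real K))" if u: "u \<in> C" for u
  proof (cases "\<bar>h u\<bar> = \<infinity>")
    case True
    then have "h u = \<infinity>" using no_minf[of u] by (cases "h u") auto
    then show ?thesis using fin by (cases "h x") auto
  next
    case False
    define c where "c = real_of_ereal (h u)"
    have "(\<Sum>k<K. 2 * \<gamma> * (F u \<bullet> (zhalf k s - u) + real_of_ereal (h (zhalf k s)) - c))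
        \<le> (\<Sum>k<K. potential u k s - potential u (Suc k) s + drift k s + noise k s \<bullet> (u - z0))"
      using C u unfolding c_def by (intro sum_mono monotone_step s mono False) auto
    also have "\<dots> = potential u 0 s - potential u K s + (\<Sum>k<K. drift k s) + noise_sum K s \<bullet> (u - z0)"
      by (simp add: sum.distrib sum_lessThan_telescope'[of "\<lambda>k. potential u k s"] inner_sum_left noise_sum_def)
    also have "\<dots> \<le> 16 * R + gap_bound K s"
    proof -
      have "potential u 0 s \<le> 2 * (norm (z0 - u))\<^sup>2"
        using \<tau> init[OF s] by (simp add: potential_def mult_left_le_one_le)
      moreover have "0 \<le> potential u K s" using \<tau> by (simp add: potential_def)
      moreover have "noise_sum K s \<bullet> (u - z0) \<le> (norm (noise_sum K s))\<^sup>2 / 56 + 14 * (norm (z0 - u))\<^sup>2"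
        using inner_le_weighted_sq[of "1/28" "noise_sum K s" "u - z0"] by (simp add: norm_minus_commute)
      ultimately show ?thesis using R[OF u] by (simp add: gap_bound_def)
    qed
    also have "(\<Sum>k<K. 2 * \<gamma> * (F u \<bullet> (zhalf k s - u) + real_of_ereal (h (zhalf k s)) - c))
        = 2 * \<gamma> * real K * (F u \<bullet> (x - u) + r - c)"
    proof -
      have "(\<Sum>k<K. zhalf k s) = real K *\<^sub>R x" using K by (simp add: x)
      then have "(\<Sum>k<K. F u \<bullet> (zhalf k s - u)) = real K * (F u \<bullet> (x - u))"
        by (simp add: inner_diff_right sum_subtractf inner_sum_right[symmetric] right_diff_distrib)
      moreover have "(\<Sum>k<K. real_of_ereal (h (zhalf k s))) = real K * r" using K by (simp add: r_def)
      ultimately have "(\<Sum>k<K. F u \<bullet> (zhalf k s - u) + real_of_ereal (h (zhalf k s)) - c)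
          = real K * (F u \<bullet> (x - u) + r - c)"
        by (simp add: sum.distrib sum_subtractf algebra_simps)
      then show ?thesis by (simp add: sum_distrib_left[symmetric])
    qed
    finally have "F u \<bullet> (x - u) + r - c \<le> (16 * R + gap_bound K s) / (2 * \<gamma> * real K)"
      using \<gamma> Kpos by (simp add: pos_le_divide_eq mult.commute)
    moreover have "ereal (F u \<bullet> (x - u)) + h x - h u \<le> ereal (F u \<bullet> (x - u) + r - c)"
      using hx fin False by (cases "h x"; cases "h u") (auto simp: c_def)
    ultimately show ?thesis by (meson ereal_less_eq(3) order.trans)
  qed
  then show "gap C F h x \<le> ereal ((16 * R + gap_bound K s) / (2 * \<gamma> * real K))"
    unfolding gap_def by (rule SUP_least)
qed

end

section \<open>Measurability and expectation of the gap\<close>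

lemma closed_gap_sublevel:
  fixes h :: "'a::euclidean_space \<Rightarrow> ereal"
  assumes h: "proper_fun h" "lsc_fun h"
  obtains T where "closed T" "\<And>x. \<bar>h x\<bar> \<noteq> \<infinity> \<Longrightarrow> x \<in> T \<longleftrightarrow> gap C F h x \<le> ereal a"
proof
  \<comment> \<open>\<open>C\<close> may be uncountable and \<open>F u\<close> need not depend
    continuously on \<open>u\<close>, so measurability is obtained from closedness. For fixed
    \<open>u\<close> in \<open>U\<close> the condition is that \<open>h\<close> lies below an affine
    function of \<open>x\<close>, a closed set by lower semicontinuity, and arbitrary intersections
    stay closed. Points outside \<open>U\<close> impose nothing where \<open>h x\<close> is
    finite.\<close>
  define U where "U = {u\<in>C. \<bar>h u\<bar> \<noteq> \<infinity>}"
  define T where "T = (\<Inter>u\<in>U. {x. h x \<le> ereal (a + real_of_ereal (h u) - F u \<bullet> (x - u))})"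
  have "closed {x. h x \<le> ereal (a + c - v \<bullet> (x - u))}" for c v u
  proof -
    have "open {x. ereal (a + c - v \<bullet> (x - u)) < h x}"
      by (intro open_lt_lsc_fun[OF h(2)] continuous_intros)
    moreover have "{x. h x \<le> ereal (a + c - v \<bullet> (x - u))} = - {x. ereal (a + c - v \<bullet> (x - u)) < h x}"
      by auto
    ultimately show ?thesis by (simp add: closed_def)
  qed
  then show "closed T" unfolding T_def by auto
  show "x \<in> T \<longleftrightarrow> gap C F h x \<le> ereal a" if fin: "\<bar>h x\<bar> \<noteq> \<infinity>" for x
  proof -
    have inf: "ereal (F u \<bullet> (x - u)) + h x - h u \<le> ereal a" if "u \<notin> U" "u \<in> C" for u
      using that fin h(1) by (cases "h u"; cases "h x") (auto simp: U_def proper_fun_def)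
    have eq: "h x \<le> ereal (a + real_of_ereal (h u) - F u \<bullet> (x - u))
        \<longleftrightarrow> ereal (F u \<bullet> (x - u)) + h x - h u \<le> ereal a" if "u \<in> U" for u
      using that fin by (cases "h u"; cases "h x") (auto simp: U_def)
    have "gap C F h x \<le> ereal a \<longleftrightarrow> (\<forall>u\<in>C. ereal (F u \<bullet> (x - u)) + h x - h u \<le> ereal a)"
      unfolding gap_def by (rule SUP_le_iff)
    also have "\<dots> \<longleftrightarrow> (\<forall>u\<in>U. ereal (F u \<bullet> (x - u)) + h x - h u \<le> ereal a)"
    proof (rule iffI[rotated])
      assume U: "\<forall>u\<in>U. ereal (F u \<bullet> (x - u)) + h x - h u \<le> ereal a"
      show "\<forall>u\<in>C. ereal (F u \<bullet> (x - u)) + h x - h u \<le> ereal a"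
      proof
        fix u assume "u \<in> C"
        then show "ereal (F u \<bullet> (x - u)) + h x - h u \<le> ereal a" using U inf[of u] by (cases "u \<in> U") simp_all
      qed
    qed (simp add: U_def)
    also have "\<dots> \<longleftrightarrow> x \<in> T" unfolding T_def using eq by auto
    finally show ?thesis by simp
  qed
qed

text \<open>The solution itself is an admissible test point. This lower bound complements
  \<open>gap_le\<close>: together they make the gap finite and dominated by an integrable
  function.\<close>

lemma gap_nonneg:
  assumes "vi_solution Z F h zs" "zs \<in> C" "x \<in> Z"
  shows "0 \<le> gap C F h x"
proof -
  have "0 \<le> ereal (F zs \<bullet> (x - zs)) + h x - h zs" using assms by (auto simp: vi_solution_def)
  also have "\<dots> \<le> gap C F h x" unfolding gap_def using assms(2) by (rule SUP_upper)
  finally show ?thesis .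
qed

context quantized_extragradient
begin

theorem monotone_gap_rate:
  fixes zhat :: "'w \<Rightarrow> 'a"
  assumes mono: "monotone_pair Z F h 0 0" and C: "compact C" "C \<subseteq> Z" "zs \<in> C" and K: "K \<ge> 1"
    and L: "0 < L" and zs: "vi_solution Z F h zs"
    and \<gamma>1: "\<gamma> \<le> sqrt (1 - \<tau>) / (2 * L * sqrt (4 * \<omega> + 2))"
    and zhat: "\<And>s. s \<in> space P \<Longrightarrow> zhat s = (1 / real K) *\<^sub>R (\<Sum>k<K. zhalf k s)"
  shows "\<And>s. s \<in> space P \<Longrightarrow> \<bar>gap C F h (zhat s)\<bar> \<noteq> \<infinity>"
    and "integrable P (\<lambda>s. real_of_ereal (gap C F h (zhat s)))"
    and "expectation (\<lambda>s. real_of_ereal (gap C F h (zhat s)))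
        \<le> 8 * (SUP u\<in>C. (norm (z0 - u))\<^sup>2) / (\<gamma> * real K) + \<gamma> * (9 * \<omega> + 2) * D\<^sup>2"
proof -
  define R where "R = (SUP u\<in>C. (norm (z0 - u))\<^sup>2)"
  define B where "B = (\<lambda>s. (16 * R + gap_bound K s) / (2 * \<gamma> * real K))"
  let ?g = "\<lambda>s. gap C F h (zhat s)"
  have Kpos: "0 < real K" using K by simp
  have le: "?g s \<le> ereal (B s)" and fin: "\<bar>h (zhat s)\<bar> \<noteq> \<infinity>" if "s \<in> space P" for s
    using gap_le[OF mono C(1,2) K that zhat[OF that]] by (simp_all add: B_def R_def)
  have nonneg: "0 \<le> ?g s" if "s \<in> space P" for s
  proof (rule gap_nonneg[OF zs C(3)])
    have "h (zhat s) < \<infinity>" using fin[OF that] by (cases "h (zhat s)") auto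
    then show "zhat s \<in> Z" using Z(2) by auto
  qed
  show finite: "\<bar>?g s\<bar> \<noteq> \<infinity>" if "s \<in> space P" for s
    using le[OF that] nonneg[OF that] by (cases "?g s") auto
  have zhat_m: "zhat \<in> borel_measurable P"
  proof (rule measurable_cong_imp)
    have "zhalf k \<in> borel_measurable P" if "k < K" for k
      by (rule history_P[OF adapted(7)[OF that]]) (use that in simp)
    then have "(\<lambda>s. \<Sum>k<K. zhalf k s) \<in> borel_measurable P"
      by (intro borel_measurable_sum) simp
    then show "(\<lambda>s. (1 / real K) *\<^sub>R (\<Sum>k<K. zhalf k s)) \<in> borel_measurable P" by simp
  qed (rule zhat)
  have gm: "(\<lambda>s. real_of_ereal (?g s)) \<in> borel_measurable P"
  proof (subst borel_measurable_iff_le, rule allI)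
    fix a
    obtain T where T: "closed T" "\<And>x. \<bar>h x\<bar> \<noteq> \<infinity> \<Longrightarrow> x \<in> T \<longleftrightarrow> gap C F h x \<le> ereal a"
      using closed_gap_sublevel[OF h(1,2)] by metis
    have "real_of_ereal (?g s) \<le> a \<longleftrightarrow> zhat s \<in> T" if s: "s \<in> space P" for s
      using T(2)[OF fin[OF s]] finite[OF s] by (cases "?g s") auto
    then have "{s \<in> space P. real_of_ereal (?g s) \<le> a} = zhat -` T \<inter> space P" by auto
    also have "\<dots> \<in> sets P" by (rule measurable_sets[OF zhat_m borel_closed[OF T(1)]])
    finally show "{s \<in> space P. real_of_ereal (?g s) \<le> a} \<in> sets P" .
  qed
  have bounds: "0 \<le> real_of_ereal (?g s)" "real_of_ereal (?g s) \<le> B s" if "s \<in> space P" for s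
    using le[OF that] nonneg[OF that] by (cases "?g s"; simp)+
  have gb: "integrable P (gap_bound K)" "expectation (gap_bound K) \<le> real K * (3 * \<gamma>\<^sup>2 * \<omega> * D\<^sup>2)"
    using gap_bound_expectation[OF L \<gamma>1, of K] by auto
  have B: "integrable P B" unfolding B_def using gb by simp
  show gi: "integrable P (\<lambda>s. real_of_ereal (?g s))"
  proof (rule Bochner_Integration.integrable_bound[OF B gm AE_I2])
    fix s assume "s \<in> space P"
    from bounds[OF this] show "norm (real_of_ereal (?g s)) \<le> norm (B s)"
      unfolding real_norm_def by linarith
  qed
  have "expectation (\<lambda>s. real_of_ereal (?g s)) \<le> expectation B"
    by (rule integral_mono[OF gi B bounds(2)])
  also have "\<dots> = (16 * R + expectation (gap_bound K)) / (2 * \<gamma> * real K)"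
    unfolding B_def using gb by (simp add: prob_space)
  also have "\<dots> \<le> (16 * R + real K * (3 * \<gamma>\<^sup>2 * \<omega> * D\<^sup>2)) / (2 * \<gamma> * real K)"
    using gb \<gamma> Kpos by (intro divide_right_mono add_left_mono) auto
  \<comment> \<open>The noise term is \<open>3/2 * \<gamma> * \<omega> * D^2\<close>, which the
    stated \<open>\<gamma> * (9 * \<omega> + 2) * D^2\<close> dominates.\<close>
  also have "\<dots> = 8 * R / (\<gamma> * real K) + \<gamma> * (3 / 2 * \<omega>) * D\<^sup>2"
    using \<gamma> Kpos by (simp add: field_simps power2_eq_square)
  also have "\<dots> \<le> 8 * R / (\<gamma> * real K) + \<gamma> * (9 * \<omega> + 2) * D\<^sup>2"
    using \<gamma> \<omega> by (intro add_left_mono mult_right_mono mult_left_mono) auto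
  finally show "expectation (\<lambda>s. real_of_ereal (?g s)) \<le> 8 * R / (\<gamma> * real K) + \<gamma> * (9 * \<omega> + 2) * D\<^sup>2" .
qed

end

text \<open>Integrability and finiteness belong to the conclusion because a non-integrable function
  has Bochner integral 0 and \<open>real_of_ereal\<close> sends infinity to 0; without them the
  bounds on the expectations could hold by default values.\<close>

theorem mainTheorem9:
  fixes P :: "'w measure" and N :: "'q measure"
    and Q :: "'q \<Rightarrow> 'a::euclidean_space \<Rightarrow> 'a"
    and F :: "'a \<Rightarrow> 'a" and Fm :: "nat \<Rightarrow> 'a \<Rightarrow> 'a" and h :: "'a \<Rightarrow> ereal"
    and Z C :: "'a set" and zs z0 :: 'a
    and \<omega> \<tau> \<gamma> L D \<mu>F \<mu>h :: real and M K :: nat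
    and idx :: "nat \<Rightarrow> 'w \<Rightarrow> nat" and \<xi> :: "nat \<Rightarrow> 'w \<Rightarrow> 'q" and coin :: "nat \<Rightarrow> 'w \<Rightarrow> bool"
    and z w zbar zhalf :: "nat \<Rightarrow> 'w \<Rightarrow> 'a" and zhat :: "'w \<Rightarrow> 'a"
  assumes h: "proper_fun h" "lsc_fun h" "convex_fun h"
    and Z: "Z \<noteq> {}" "closed Z" "convex Z" "{x. h x < \<infinity>} \<subseteq> Z"
    and \<tau>: "0 \<le> \<tau>" "\<tau> < 1"
    and M: "M \<ge> 1"
    and K: "K \<ge> 1"
    and F: "\<And>x. F x = (1 / real M) *\<^sub>R (\<Sum>m=1..M. Fm m x)"
    and Fm_measurable: "\<And>m. m \<in> {1..M} \<Longrightarrow> Fm m \<in> borel_measurable (restrict_space borel Z)"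
    and LD: "0 < L" "0 \<le> D"
    and F_lipschitz: "boundedly_lipschitz Z L D F"
    and Fm_lipschitz: "\<And>m. m \<in> {1..M} \<Longrightarrow> boundedly_lipschitz Z L D (Fm m)"
    and solution: "vi_solution Z F h zs"
    and Q: "quantization N Q \<omega>"
    and P: "prob_space P"
    and draws_indep: "prob_space.indep_vars P (\<lambda>_. draw_law M N \<tau>)
           (\<lambda>k s. (idx k s, \<xi> k s, coin k s)) {..<K}"
    and draws_law: "\<And>k. k < K \<Longrightarrow>
           distr P (draw_law M N \<tau>) (\<lambda>s. (idx k s, \<xi> k s, coin k s)) = draw_law M N \<tau>"
    and z0: "z0 \<in> Z"
    and init: "\<And>s. s \<in> space P \<Longrightarrow> z 0 s = z0" "\<And>s. s \<in> space P \<Longrightarrow> w 0 s = z0"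
    and zbar: "\<And>k s. k < K \<Longrightarrow> s \<in> space P \<Longrightarrow>
           zbar k s = \<tau> *\<^sub>R z k s + (1 - \<tau>) *\<^sub>R w k s"
    and zhalf: "\<And>k s. k < K \<Longrightarrow> s \<in> space P \<Longrightarrow>
           zhalf k s = prox \<gamma> h (zbar k s - \<gamma> *\<^sub>R F (w k s))"
    and z_step: "\<And>k s. k < K \<Longrightarrow> s \<in> space P \<Longrightarrow>
           z (k + 1) s = prox \<gamma> h (zbar k s
             - \<gamma> *\<^sub>R Q (\<xi> k s) (Fm (idx k s) (zhalf k s) - Fm (idx k s) (w k s))
             - \<gamma> *\<^sub>R F (w k s))"
    and w_step: "\<And>k s. k < K \<Longrightarrow> s \<in> space P \<Longrightarrow>
           w (k + 1) s = (if coin k s then z (k + 1) s else w k s)"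
    and zhat: "\<And>s. s \<in> space P \<Longrightarrow> zhat s = (1 / real K) *\<^sub>R (\<Sum>k<K. zhalf k s)"
  shows
    "(0 \<le> \<mu>F \<and> 0 \<le> \<mu>h \<and> 0 < \<mu>F + \<mu>h \<and> monotone_pair Z F h \<mu>F \<mu>h \<and>
      0 < \<gamma> \<and> \<gamma> \<le> min (sqrt (1 - \<tau>) / (2 * L * sqrt (2 * \<omega>))) ((1 - \<tau>) / (4 * (\<mu>F + \<mu>h)))
      \<longrightarrow>
      integrable P (\<lambda>s. \<tau> * (norm (z K s - zs))\<^sup>2 + (norm (w K s - zs))\<^sup>2) \<and>
      prob_space.expectation P (\<lambda>s. \<tau> * (norm (z K s - zs))\<^sup>2 + (norm (w K s - zs))\<^sup>2)
        \<le> (1 - \<gamma> * ((\<mu>F + \<mu>h) / 16)) ^ (K - 1)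
             * (\<tau> * (norm (z0 - zs))\<^sup>2 + (norm (z0 - zs))\<^sup>2)
           + 32 * \<gamma> * \<omega> * D\<^sup>2 / (\<mu>F + \<mu>h))
     \<and>
     (monotone_pair Z F h 0 0 \<and> compact C \<and> C \<subseteq> Z \<and> zs \<in> C \<and>
      0 < \<gamma> \<and> \<gamma> \<le> sqrt (1 - \<tau>) / (2 * L * sqrt (4 * \<omega> + 2))
      \<longrightarrow>
      (AE s in P. \<bar>gap C F h (zhat s)\<bar> \<noteq> \<infinity>) \<and>
      integrable P (\<lambda>s. real_of_ereal (gap C F h (zhat s))) \<and>
      prob_space.expectation P (\<lambda>s. real_of_ereal (gap C F h (zhat s)))
        \<le> 8 * (SUP u\<in>C. (norm (z0 - u))\<^sup>2) / (\<gamma> * real K) + \<gamma> * (9 * \<omega> + 2) * D\<^sup>2)"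
proof (intro conjI impI)
  have qe: "quantized_extragradient P N Q F Fm h Z z0 \<omega> \<tau> \<gamma> L D M K idx \<xi> coin z w zbar zhalf" if "0 < \<gamma>"
    by (intro quantized_extragradient.intro quantized_extragradient_axioms.intro P)
      (fact h Z \<tau> M F Fm_measurable F_lipschitz Fm_lipschitz Q draws_indep draws_law z0 init zbar zhalf z_step w_step that)+
  {
    assume *: "0 \<le> \<mu>F \<and> 0 \<le> \<mu>h \<and> 0 < \<mu>F + \<mu>h \<and> monotone_pair Z F h \<mu>F \<mu>h \<and>
      0 < \<gamma> \<and> \<gamma> \<le> min (sqrt (1 - \<tau>) / (2 * L * sqrt (2 * \<omega>))) ((1 - \<tau>) / (4 * (\<mu>F + \<mu>h)))"
    then interpret quantized_extragradient P N Q F Fm h Z z0 \<omega> \<tau> \<gamma> L D M K idx \<xi> coin z w zbar zhalf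
      by (intro qe) simp
    show "integrable P (\<lambda>s. \<tau> * (norm (z K s - zs))\<^sup>2 + (norm (w K s - zs))\<^sup>2)"
      using potential_integrable[of K zs] by (simp add: potential_def[abs_def])
    show "expectation (\<lambda>s. \<tau> * (norm (z K s - zs))\<^sup>2 + (norm (w K s - zs))\<^sup>2)
        \<le> (1 - \<gamma> * ((\<mu>F + \<mu>h) / 16)) ^ (K - 1)
             * (\<tau> * (norm (z0 - zs))\<^sup>2 + (norm (z0 - zs))\<^sup>2)
           + 32 * \<gamma> * \<omega> * D\<^sup>2 / (\<mu>F + \<mu>h)"
      using strongly_monotone_rate[of \<mu>F \<mu>h zs] * LD(1) solution by (simp add: potential_def[abs_def])
  next
    assume *: "monotone_pair Z F h 0 0 \<and> compact C \<and> C \<subseteq> Z \<and> zs \<in> C \<and>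
      0 < \<gamma> \<and> \<gamma> \<le> sqrt (1 - \<tau>) / (2 * L * sqrt (4 * \<omega> + 2))"
    then interpret quantized_extragradient P N Q F Fm h Z z0 \<omega> \<tau> \<gamma> L D M K idx \<xi> coin z w zbar zhalf
      by (intro qe) simp
    have mono: "monotone_pair Z F h 0 0" and C: "compact C" "C \<subseteq> Z" "zs \<in> C"
      and \<gamma>1: "\<gamma> \<le> sqrt (1 - \<tau>) / (2 * L * sqrt (4 * \<omega> + 2))" using * by auto
    note rate = monotone_gap_rate[OF mono C K LD(1) solution \<gamma>1 zhat]
    show "AE s in P. \<bar>gap C F h (zhat s)\<bar> \<noteq> \<infinity>" by (rule AE_I2) (rule rate(1))
    show "integrable P (\<lambda>s. real_of_ereal (gap C F h (zhat s)))" by (rule rate(2))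
    show "expectation (\<lambda>s. real_of_ereal (gap C F h (zhat s)))
        \<le> 8 * (SUP u\<in>C. (norm (z0 - u))\<^sup>2) / (\<gamma> * real K) + \<gamma> * (9 * \<omega> + 2) * D\<^sup>2" by (rule rate(3))
  }
qed

end
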